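(* In the three-path network with travel costs $(c_1,c_2,c_3)=(0,c_H/2,c_H)$, let $(x_1^*,x_2^*,x_3^* )$ be the social welfare maximizer. The side-payment functions on paths $P_1$ and $P_2$ $$g^1(x_1,x_2,x_3)=\frac{(1-x_2-x_3)(x_2^*c_2+x_3^*c_3)}{1-x_2^*-x_3^*},$$ $$g^2(x_1,x_2,x_3)=-\frac{(1-x_2-x_3)^2x_2^*c_2}{(1-x_2^*-x_3^* )x_2}+x_3(c_3-c_2)$$ incentivize users to choose paths $P_2$ and $P_3$ and to converge from any initial flow to $(x_1^*,x_2^*,x_3^* )$. The side payment on path $P_1$ is larger than that on $P_2$ (i.e. $g^1>g^2$). This side-payment mechanism achieves price of anarchy $PoA_g=1$, without any loss of system efficiency.
   Context: A unit mass of non-atomic users, all of valuation $\theta_0$, travels from $s$ to $t$. All routes share a costless common link on which the fixed content $Q_0$ is collected; then each user selects one of three parallel links $P_1,P_2,P_3$ with travel costs $c_1=0$, $c_2=c_H/2$, $c_3=c_H$, where $c_H>0$. A flow is $(x_1,x_2,x_3)$ with $x_k\ge0$ and $x_1+x_2+x_3=1$. The total content is $Q(x_1,x_2,x_3)=Q_0+\sum_{k=1}^3Q_1(x_k)$, where $Q_1(x)$, the content collected on a link by a mass $x$ of users, is increasing and concave. Social welfare is $SW(x_1,x_2,x_3)=\theta_0Q(x_1,x_2,x_3)-\sum_kc_kx_k$, maximized at $(x_1^*,x_2^*,x_3^* )$. Under side payments, each user on $P_k$ pays $g^k$ (a negative value is a subsidy), where the money refunded to users on $P_3$ is determined by budget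 balance, $x_1g^1+x_2g^2+x_3g^3=0$; the payoff on $P_k$ is $\theta_0Q(x_1,x_2,x_3)-c_k-g^k(x_1,x_2,x_3)$. A flow is an equilibrium if no user can increase her payoff by deviating to another path. To incentivize a flow means to obtain it as an (asymptotically) stable equilibrium. Writing $C_k=c_k+g^k$ for the perceived cost on $P_k$, the flow dynamics considered are those in which flow switches from $P_k$ to $P_l$ at rate $x_k\max\{0,C_k-C_l\}$. The price of anarchy $PoA_g$ is the minimum, over all system parameters and content functions, of the ratio between the lowest social welfare at any equilibrium under the mechanism and the optimal social welfare.
   Formalization: The inequality g^1>g^2 is asserted only at the optimal flow x* and only when x_2^*>0; as an inequality at all flows it fails (at x_1=0, g^1=0≤g^2), and it also fails when x_2^*=0, where g^1 is identically 0 and g^2≥0. *)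

theory Defs
  imports "HOL-Analysis.Analysis"
begin

text \<open>
  The paths \<open>P\<^sub>1, P\<^sub>2, P\<^sub>3\<close> are the elements \<open>1, 2, 3\<close> of the index type \<open>3\<close>; a flow is a vector
  of type \<open>real ^ 3\<close>.
\<close>

record network =
  valuation :: real                    \<comment> \<open>\<open>\<theta>\<^sub>0\<close>\<close>
  common_content :: real               \<comment> \<open>\<open>Q\<^sub>0\<close>\<close>
  link_content :: "real \<Rightarrow> real"       \<comment> \<open>\<open>Q\<^sub>1\<close>\<close>
  high_cost :: real                    \<comment> \<open>\<open>c\<^sub>H\<close>\<close>

text \<open>Monotonicity of \<open>Q\<^sub>1\<close> is not required to be strict, and \<open>Q\<^sub>1\<close> only matters on \<open>[0,1]\<close>.\<close>

definition valid_network :: "network \<Rightarrow> bool" where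
  "valid_network N \<longleftrightarrow>
     valuation N > 0 \<and> common_content N \<ge> 0 \<and> high_cost N > 0 \<and>
     link_content N 0 \<ge> 0 \<and> mono_on {0..1} (link_content N) \<and> concave_on {0..1} (link_content N)"

definition travel_cost :: "network \<Rightarrow> 3 \<Rightarrow> real" where
  "travel_cost N k = (if k = 1 then 0 else if k = 2 then high_cost N / 2 else high_cost N)"

definition flows :: "(real ^ 3) set" where
  "flows = {x. (\<forall>k. x $ k \<ge> 0) \<and> (\<Sum>k\<in>UNIV. x $ k) = 1}"

definition total_content :: "network \<Rightarrow> real ^ 3 \<Rightarrow> real" where
  "total_content N x = common_content N + (\<Sum>k\<in>UNIV. link_content N (x $ k))"

definition social_welfare :: "network \<Rightarrow> real ^ 3 \<Rightarrow> real" where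
  "social_welfare N x =
     valuation N * total_content N x - (\<Sum>k\<in>UNIV. travel_cost N k * x $ k)"

definition optimal_flow :: "network \<Rightarrow> real ^ 3 \<Rightarrow> bool" where
  "optimal_flow N x \<longleftrightarrow> x \<in> flows \<and> (\<forall>y\<in>flows. social_welfare N y \<le> social_welfare N x)"

text \<open>
  A side-payment scheme assigns to each flow and path the payment of one user of that path.
  Payments are extended reals because a fixed positive amount shared among the users of a path
  is an unbounded subsidy per user as the path empties. In \<open>ereal\<close>, \<open>a / 0\<close> is \<open>- \<infinity>\<close> for \<open>a < 0\<close>
  and \<open>\<infinity>\<close> for \<open>a > 0\<close>, while \<open>0 / 0 = 0\<close> and \<open>0 * - \<infinity> = 0\<close>. So an empty path with money to
  refund offers an infinite subsidy, an empty path with nothing to refund offers none, and no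
  payment is collected from or made to an empty path.
\<close>

type_synonym payments = "real ^ 3 \<Rightarrow> 3 \<Rightarrow> ereal"

text \<open>The payment on \<open>P\<^sub>3\<close> solves \<open>x\<^sub>1 g\<^sup>1 + x\<^sub>2 g\<^sup>2 + x\<^sub>3 g\<^sup>3 = 0\<close>.\<close>

definition budget_balanced_payments ::
    "(real ^ 3 \<Rightarrow> ereal) \<Rightarrow> (real ^ 3 \<Rightarrow> ereal) \<Rightarrow> payments" where
  "budget_balanced_payments g1 g2 x k =
     (if k = 1 then g1 x
      else if k = 2 then g2 x
      else - (ereal (x $ 1) * g1 x + ereal (x $ 2) * g2 x) / ereal (x $ 3))"

definition payoff :: "network \<Rightarrow> payments \<Rightarrow> real ^ 3 \<Rightarrow> 3 \<Rightarrow> ereal" where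
  "payoff N g x k = ereal (valuation N * total_content N x) - ereal (travel_cost N k) - g x k"

text \<open>Users are non-atomic, so a deviation by one of them leaves the flow unchanged.\<close>

definition equilibrium :: "network \<Rightarrow> payments \<Rightarrow> real ^ 3 \<Rightarrow> bool" where
  "equilibrium N g x \<longleftrightarrow>
     x \<in> flows \<and> (\<forall>k l. x $ k > 0 \<longrightarrow> payoff N g x l \<le> payoff N g x k)"

definition perceived_cost :: "network \<Rightarrow> payments \<Rightarrow> real ^ 3 \<Rightarrow> 3 \<Rightarrow> ereal" where
  "perceived_cost N g x k = ereal (travel_cost N k) + g x k"

definition switch_rate :: "network \<Rightarrow> payments \<Rightarrow> real ^ 3 \<Rightarrow> 3 \<Rightarrow> 3 \<Rightarrow> ereal" where
  "switch_rate N g x k l =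
     ereal (x $ k) * max 0 (perceived_cost N g x k - perceived_cost N g x l)"

text \<open>
  The differential equation is imposed at all \<open>t > 0\<close>, and only continuity at \<open>t = 0\<close>. Hence
  initial flows with an infinite switching rate, such as \<open>(1, 0, 0)\<close>, are admitted. A trajectory
  cannot be at such a flow at a positive time, as a real derivative cannot equal an infinite rate.
\<close>

definition trajectory :: "network \<Rightarrow> payments \<Rightarrow> (real \<Rightarrow> real ^ 3) \<Rightarrow> bool" where
  "trajectory N g x \<longleftrightarrow>
     continuous_on {0..} x \<and> (\<forall>t\<ge>0. x t \<in> flows) \<and>
     (\<forall>t>0. \<exists>v. (x has_vector_derivative v) (at t) \<and>
        (\<forall>k. ereal (v $ k) =
           (\<Sum>l\<in>UNIV. switch_rate N g (x t) l k) - (\<Sum>l\<in>UNIV. switch_rate N g (x t) k l)))"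

definition asymptotically_stable :: "network \<Rightarrow> payments \<Rightarrow> real ^ 3 \<Rightarrow> bool" where
  "asymptotically_stable N g z \<longleftrightarrow>
     (\<forall>\<epsilon>>0. \<exists>\<delta>>0. \<forall>x. trajectory N g x \<and> dist (x 0) z < \<delta> \<longrightarrow> (\<forall>t\<ge>0. dist (x t) z < \<epsilon>)) \<and>
     (\<exists>\<delta>>0. \<forall>x. trajectory N g x \<and> dist (x 0) z < \<delta> \<longrightarrow> (x \<longlongrightarrow> z) at_top)"

definition incentivizes :: "network \<Rightarrow> payments \<Rightarrow> real ^ 3 \<Rightarrow> bool" where
  "incentivizes N g z \<longleftrightarrow> equilibrium N g z \<and> asymptotically_stable N g z"

definition converges_from_any_flow :: "network \<Rightarrow> payments \<Rightarrow> real ^ 3 \<Rightarrow> bool" where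
  "converges_from_any_flow N g z \<longleftrightarrow>
     (\<forall>x0\<in>flows. (\<exists>x. trajectory N g x \<and> x 0 = x0) \<and>
        (\<forall>x. trajectory N g x \<and> x 0 = x0 \<longrightarrow> (x \<longlongrightarrow> z) at_top))"

text \<open>
  A mechanism depends on the network and on the optimal flow it targets. The welfare condition
  makes the ratio meaningful; for a valid network it fails only if there is no content at all.
\<close>

definition price_of_anarchy :: "(network \<Rightarrow> real ^ 3 \<Rightarrow> payments) \<Rightarrow> ereal" where
  "price_of_anarchy M =
     (INF (N, z) \<in> {(N, z). valid_network N \<and> optimal_flow N z \<and> social_welfare N z > 0}.
        INF x \<in> {x. equilibrium N (M N z) x}. ereal (social_welfare N x / social_welfare N z))"

definition side_payment1 :: "network \<Rightarrow> real ^ 3 \<Rightarrow> real ^ 3 \<Rightarrow> ereal" where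
  "side_payment1 N z x =
     ereal ((1 - x $ 2 - x $ 3) * (z $ 2 * travel_cost N 2 + z $ 3 * travel_cost N 3)) /
     ereal (1 - z $ 2 - z $ 3)"

definition side_payment2 :: "network \<Rightarrow> real ^ 3 \<Rightarrow> real ^ 3 \<Rightarrow> ereal" where
  "side_payment2 N z x =
     - (ereal ((1 - x $ 2 - x $ 3)\<^sup>2 * (z $ 2) * travel_cost N 2) /
        ereal ((1 - z $ 2 - z $ 3) * (x $ 2))) +
     ereal (x $ 3 * (travel_cost N 3 - travel_cost N 2))"

definition side_payments :: "network \<Rightarrow> real ^ 3 \<Rightarrow> payments" where
  "side_payments N z = budget_balanced_payments (side_payment1 N z) (side_payment2 N z)"

end

theory Submission
  imports Defs "HOL-Complex_Analysis.Great_Picard" "HOL-Real_Asymp.Real_Asymp"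
begin

text \<open>
  Swapping components of the maximizer shows \<open>z\<^sub>1 \<ge> z\<^sub>2 \<ge> z\<^sub>3\<close>. Under the side payments the
  perceived costs \<open>C\<close> are monotone: along a direction \<open>v\<close> with components adding up to 0, the
  quadratic form of the derivative of \<open>C\<close> is a positive combination of
  \<open>(v\<^sub>1 - (x\<^sub>1 / x\<^sub>2) v\<^sub>2)\<^sup>2\<close> and \<open>(v\<^sub>1 - (x\<^sub>1 / x\<^sub>3) v\<^sub>3)\<^sup>2\<close>. For such costs the function
  \<open>V = \<Sum>k l. x\<^sub>k (max 0 (C\<^sub>k - C\<^sub>l))\<^sup>2\<close> decreases along the dynamics, at least as fast as the sum of
  the corresponding cubes, and this forces \<open>V \<le> 12 / t\<^sup>2\<close> whatever the initial flow is. Moreover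
  \<open>\<Sum>k. (x\<^sub>k - z\<^sub>k) C\<^sub>k\<close> has a closed form that controls the distance from \<open>x\<close> to \<open>z\<close> and is itself
  controlled by \<open>V\<close>. This gives convergence, stability and uniqueness of the equilibrium.

  Trajectories from singular initial flows are limits of solutions of regularised equations, with
  \<open>x\<^sub>k + e\<close> in place of \<open>x\<^sub>k\<close> in the singular denominators. The regularised costs are monotone as
  well, so the bound on \<open>V\<close> is uniform in \<open>e\<close> and keeps the solutions away from the singular faces
  at positive times. As \<open>x\<^sub>k C\<^sub>k\<close> is bounded below, each \<open>x\<^sub>k\<^sup>2\<close> grows at a bounded rate, which makes the
  solutions equicontinuous up to time 0.
\<close>

section \<open>Smith dynamics\<close>

text \<open>The Smith dynamic of evolutionary game theory: inflow minus outflow. Costs enter as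
  plain numbers, so the algebra serves the true and the regularised costs alike.\<close>

definition smith_field :: "('n::finite \<Rightarrow> real) \<Rightarrow> real ^ 'n \<Rightarrow> 'n \<Rightarrow> real" where
  "smith_field C x k =
     (\<Sum>l\<in>UNIV. x $ l * max 0 (C l - C k)) - (\<Sum>l\<in>UNIV. x $ k * max 0 (C k - C l))"

text \<open>Smith's Lyapunov function. For nonnegative masses it vanishes exactly when no used path
  is costlier than another path.\<close>

definition disequilibrium :: "('n::finite \<Rightarrow> real) \<Rightarrow> real ^ 'n \<Rightarrow> real" where
  "disequilibrium C x = (\<Sum>k\<in>UNIV. \<Sum>l\<in>UNIV. x $ k * (max 0 (C k - C l))\<^sup>2)"

text \<open>Squaring smooths the kink of the positive part, which makes
  \<open>disequilibrium\<close> differentiable.\<close>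

lemma has_real_derivative_max_0_power2:
  "((\<lambda>d::real. (max 0 d)\<^sup>2) has_real_derivative 2 * max 0 d) (at d)"
proof -
  consider "d > 0" | "d < 0" | "d = 0" by linarith
  then show ?thesis
  proof cases
    case 1
    have "((\<lambda>d. d\<^sup>2) has_real_derivative 2 * max 0 d) (at d)"
      using 1 by (auto intro!: derivative_eq_intros)
    moreover have "\<forall>\<^sub>F y in nhds d. y\<^sup>2 = (max 0 y)\<^sup>2"
      using eventually_nhds_in_open[of "{0<..}" d] 1 by (auto elim!: eventually_mono)
    ultimately show ?thesis
      using DERIV_cong_ev[of d d "\<lambda>d. d\<^sup>2" "\<lambda>d. (max 0 d)\<^sup>2"] by blast
  next
    case 2
    have "((\<lambda>d. 0) has_real_derivative 2 * max 0 d) (at d)"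
      using 2 by (auto intro!: derivative_eq_intros)
    moreover have "\<forall>\<^sub>F y in nhds d. 0 = (max 0 y)\<^sup>2"
      using eventually_nhds_in_open[of "{..<0}" d] 2 by (auto elim!: eventually_mono)
    ultimately show ?thesis
      using DERIV_cong_ev[of d d "\<lambda>d. 0" "\<lambda>d. (max 0 d)\<^sup>2"] by blast
  next
    case 3
    \<comment> \<open>Away from 0, the difference quotient of the square at 0 is the positive part
      itself.\<close>
    have "((\<lambda>y::real. max 0 y) \<longlongrightarrow> 0) (at 0)"
      by (auto intro!: tendsto_eq_intros)
    then have "((\<lambda>y::real. ((max 0 y)\<^sup>2 - (max 0 0)\<^sup>2) / (y - 0)) \<longlongrightarrow> 0) (at 0)"
      by (rule Lim_transform_eventually)
        (auto simp: eventually_at_filter power2_eq_square max_def)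
    then show ?thesis
      using 3 by (simp add: has_field_derivative_iff)
  qed
qed

text \<open>Summation by parts: a switch from \<open>k\<close> to \<open>l\<close> changes the
  weighted mass by \<open>c l - c k\<close>. It is applied with constant weights, with sums of
  squared excesses and with cost derivatives.\<close>

lemma smith_field_balance:
  "(\<Sum>k\<in>UNIV. c k * smith_field C x k) =
     (\<Sum>k\<in>UNIV. \<Sum>l\<in>UNIV. x $ k * max 0 (C k - C l) * (c l - c k))"
proof -
  have "(\<Sum>k\<in>UNIV. c k * (\<Sum>l\<in>UNIV. x $ l * max 0 (C l - C k))) =
      (\<Sum>k\<in>UNIV. \<Sum>l\<in>UNIV. c k * (x $ l * max 0 (C l - C k)))"
    by (simp add: sum_distrib_left)
  also have "\<dots> = (\<Sum>k\<in>UNIV. \<Sum>l\<in>UNIV. c l * (x $ k * max 0 (C k - C l)))"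
    by (rule sum.swap)
  finally show ?thesis
    unfolding smith_field_def right_diff_distrib sum_subtractf sum_distrib_left
    by (simp add: mult_ac)
qed

lemma sum_smith_field: "(\<Sum>k\<in>UNIV. smith_field C x k) = 0"
  using smith_field_balance[of "\<lambda>_. 1" C x] by simp

lemma disequilibrium_nonneg: "(\<And>k. x $ k \<ge> 0) \<Longrightarrow> disequilibrium C x \<ge> 0"
  unfolding disequilibrium_def by (intro sum_nonneg) auto

lemma mult_excess_square_le_disequilibrium:
  assumes "\<And>k. x $ k \<ge> 0"
  shows "x $ k * (max 0 (C k - C l))\<^sup>2 \<le> disequilibrium C x"
proof -
  have "x $ k * (max 0 (C k - C l))\<^sup>2 \<le> (\<Sum>l\<in>UNIV. x $ k * (max 0 (C k - C l))\<^sup>2)"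
    using assms by (intro member_le_sum) auto
  also have "\<dots> \<le> disequilibrium C x"
    unfolding disequilibrium_def using assms
    by (intro member_le_sum[of k UNIV "\<lambda>k. \<Sum>l\<in>UNIV. x $ k * (max 0 (C k - C l))\<^sup>2"])
      (auto intro!: sum_nonneg)
  finally show ?thesis .
qed

text \<open>The change of the masses contributes \<open>\<Sum>k. H k * x' k\<close> with
  \<open>H k = \<Sum>m. (max 0 (C k - C m))\<^sup>2\<close>, and every switch from \<open>k\<close> to \<open>l\<close> lowers \<open>H\<close> by at least
  \<open>(C k - C l)\<^sup>2\<close>. The change of the costs contributes \<open>- 2 * (\<Sum>k. C' k * x' k)\<close>.\<close>

lemma disequilibrium_has_derivative:
  fixes x :: "real \<Rightarrow> real ^ 'n::finite" and C :: "real \<Rightarrow> 'n \<Rightarrow> real"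
  assumes dx: "\<And>k. ((\<lambda>s. x s $ k) has_real_derivative smith_field (C t) (x t) k) (at t)"
    and dC: "\<And>k. ((\<lambda>s. C s k) has_real_derivative C' k) (at t)"
    and nonneg: "\<And>k. x t $ k \<ge> 0"
    and monotone: "(\<Sum>k\<in>UNIV. C' k * smith_field (C t) (x t) k) \<ge> 0"
  shows "\<exists>D. ((\<lambda>s. disequilibrium (C s) (x s)) has_real_derivative D) (at t) \<and>
     D \<le> - (\<Sum>k\<in>UNIV. \<Sum>l\<in>UNIV. x t $ k * max 0 (C t k - C t l) ^ 3)"
proof -
  define X where "X k = x t $ k" for k
  define r where "r k l = max 0 (C t k - C t l)" for k l
  define x' where "x' = smith_field (C t) (x t)"
  define H where "H k = (\<Sum>l\<in>UNIV. (r k l)\<^sup>2)" for k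
  define D where "D = (\<Sum>k\<in>UNIV. \<Sum>l\<in>UNIV. x' k * (r k l)\<^sup>2 + X k * (2 * r k l * (C' k - C' l)))"
  have "((\<lambda>s. disequilibrium (C s) (x s)) has_real_derivative D) (at t)"
    unfolding disequilibrium_def D_def x'_def r_def X_def
    by (rule derivative_eq_intros refl dx dC DERIV_chain2[OF has_real_derivative_max_0_power2]
          | simp add: mult_ac)+
  moreover have "D = (\<Sum>k\<in>UNIV. H k * x' k) - 2 * (\<Sum>k\<in>UNIV. C' k * x' k)"
  proof -
    have "D = (\<Sum>k\<in>UNIV. H k * x' k)
        - 2 * (\<Sum>k\<in>UNIV. \<Sum>l\<in>UNIV. X k * r k l * (C' l - C' k))"
      unfolding D_def H_def sum_distrib_left sum_distrib_right sum_subtractf[symmetric]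
      by (intro sum.cong refl) (simp add: algebra_simps)
    then show ?thesis
      unfolding x'_def smith_field_balance by (simp add: X_def r_def)
  qed
  moreover have "(\<Sum>k\<in>UNIV. H k * x' k) \<le> - (\<Sum>k\<in>UNIV. \<Sum>l\<in>UNIV. X k * r k l ^ 3)"
  proof -
    have "X k * r k l * (H l - H k) \<le> - (X k * r k l ^ 3)" for k l
    proof (cases "C t k > C t l")
      case True
      \<comment> \<open>The cheaper path \<open>l\<close> has no excess over \<open>k\<close>, its
        excess over any other path is at most that of \<open>k\<close>, and its own term
        \<open>m = l\<close> vanishes. The last fact yields the gain
        \<open>(r k l)\<^sup>2\<close>.\<close>
      have "H l = (\<Sum>m\<in>UNIV - {k}. (r l m)\<^sup>2)"
        unfolding H_def using True by (subst sum.remove[of UNIV k]) (auto simp: r_def)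
      also have "\<dots> \<le> (\<Sum>m\<in>UNIV - {k}. (r k m)\<^sup>2 - (if m = l then (r k m)\<^sup>2 else 0))"
        using True by (intro sum_mono) (auto simp: r_def intro!: power_mono)
      also have "\<dots> = H k - (r k l)\<^sup>2"
        using True unfolding H_def
        by (subst sum.remove[of UNIV k]) (auto simp: sum_subtractf r_def)
      finally have "X k * r k l * (H l - H k) \<le> X k * r k l * - (r k l)\<^sup>2"
        using nonneg by (intro mult_left_mono) (auto simp: X_def r_def)
      then show ?thesis
        by (simp add: power3_eq_cube power2_eq_square mult.assoc)
    qed (simp add: r_def)
    then show ?thesis
      unfolding x'_def smith_field_balance X_def[symmetric] r_def[symmetric]
        sum_negf[symmetric] by (intro sum_mono) blast
  qed
  ultimately show ?thesis
    using monotone unfolding x'_def X_def r_def by (intro exI[of _ D]) auto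
qed

text \<open>The tangent of the convex function \<open>r \<mapsto> r powr (3 / 2)\<close>, applied to \<open>r\<^sup>2\<close>.\<close>

lemma cube_ge_tangent:
  fixes r e :: real
  assumes "r \<ge> 0" "e \<ge> 0"
  shows "r ^ 3 \<ge> 3 / 2 * e * r\<^sup>2 - e ^ 3 / 2"
proof -
  have "r ^ 3 - (3 / 2 * e * r\<^sup>2 - e ^ 3 / 2) = (r - e)\<^sup>2 * (r + e / 2)"
    by (simp add: power2_eq_square power3_eq_cube algebra_simps)
  then show ?thesis
    using assms by (smt (verit) mult_nonneg_nonneg zero_le_power2 divide_nonneg_nonneg)
qed

text \<open>A linearised Hoelder bound between cubes and squares. The masses add up to 1, so each
  target path contributes the constant of the tangent inequality once. The free \<open>e\<close> is
  tuned to the elapsed time in \<open>V_decay\<close>.\<close>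

lemma sum_excess_cube_ge:
  fixes e :: real
  assumes "\<And>k. x $ k \<ge> 0" "(\<Sum>k\<in>UNIV. x $ k) = 1" "e \<ge> 0"
  shows "(\<Sum>k\<in>UNIV. \<Sum>l\<in>(UNIV::'n::finite set). x $ k * max 0 (C k - C l) ^ 3)
      \<ge> 3 / 2 * e * disequilibrium C x - CARD('n) * e ^ 3 / 2"
proof -
  have "(\<Sum>k\<in>UNIV. \<Sum>l\<in>(UNIV::'n set). x $ k * (3 / 2 * e * (max 0 (C k - C l))\<^sup>2 - e ^ 3 / 2))
      \<le> (\<Sum>k\<in>UNIV. \<Sum>l\<in>(UNIV::'n set). x $ k * max 0 (C k - C l) ^ 3)"
    using assms by (intro sum_mono mult_left_mono cube_ge_tangent) auto
  moreover have "(\<Sum>k\<in>UNIV. \<Sum>l\<in>(UNIV::'n set). x $ k * (e ^ 3 / 2)) = CARD('n) * e ^ 3 / 2"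
    using assms(2) by (simp add: sum_distrib_left[symmetric] sum_divide_distrib[symmetric] sum_distrib_right[symmetric])
  moreover have "(\<Sum>k\<in>UNIV. \<Sum>l\<in>(UNIV::'n set). x $ k * (3 / 2 * e * (max 0 (C k - C l))\<^sup>2))
      = 3 / 2 * e * disequilibrium C x"
    by (simp add: disequilibrium_def sum_distrib_left mult_ac)
  ultimately show ?thesis
    by (simp add: right_diff_distrib sum_subtractf)
qed

text \<open>Cauchy-Schwarz over ordered pairs, with each mass split into two square roots. It leads
  from the decaying disequilibrium to the mean excess that bounds the distance from the
  target.\<close>

lemma sum_excess_square_le:
  assumes "\<And>k. x $ k \<ge> 0" "(\<Sum>k\<in>UNIV. x $ k) = 1"
  shows "(\<Sum>k\<in>UNIV. \<Sum>l\<in>(UNIV::'n::finite set). x $ k * max 0 (C k - C l))\<^sup>2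
      \<le> CARD('n) * disequilibrium C x"
proof -
  let ?f = "\<lambda>(k::'n, l::'n). sqrt (x $ k)" and ?g = "\<lambda>(k, l). sqrt (x $ k) * max 0 (C k - C l)"
  have "(\<Sum>p\<in>UNIV. ?f p * ?g p)\<^sup>2 \<le> (\<Sum>p\<in>UNIV. (?f p)\<^sup>2) * (\<Sum>p\<in>(UNIV::('n \<times> 'n) set). (?g p)\<^sup>2)"
    by (rule Cauchy_Schwarz_ineq_sum)
  moreover have "(\<Sum>p\<in>UNIV. ?f p * ?g p) = (\<Sum>k\<in>UNIV. \<Sum>l\<in>UNIV. x $ k * max 0 (C k - C l))"
    using assms(1) by (auto simp: sum.cartesian_product split_def mult.assoc[symmetric] intro!: sum.cong)
  moreover have "(\<Sum>p\<in>UNIV. (?g p)\<^sup>2) = disequilibrium C x"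
    using assms(1) by (auto simp: disequilibrium_def sum.cartesian_product split_def power_mult_distrib intro!: sum.cong)
  moreover have "(\<Sum>p\<in>UNIV. (?f p)\<^sup>2) = (\<Sum>k\<in>UNIV. \<Sum>l\<in>(UNIV::'n set). x $ k)"
    unfolding sum.cartesian_product UNIV_Times_UNIV
    using assms(1) by (auto intro!: sum.cong)
  moreover have "\<dots> = CARD('n)"
    using assms(2) by (simp add: sum_distrib_left[symmetric])
  ultimately show ?thesis by simp
qed

lemma disequilibrium_tendsto:
  assumes "\<And>k. ((\<lambda>s. C s k) \<longlongrightarrow> c k) F" "(x \<longlongrightarrow> y) F"
  shows "((\<lambda>s. disequilibrium (C s) (x s)) \<longlongrightarrow> disequilibrium c y) F"
  unfolding disequilibrium_def by (intro tendsto_intros assms)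

lemma smith_field_tendsto:
  assumes "\<And>k. ((\<lambda>s. C s k) \<longlongrightarrow> c k) F" "(x \<longlongrightarrow> y) F"
  shows "((\<lambda>s. smith_field (C s) (x s) k) \<longlongrightarrow> smith_field c y k) F"
  unfolding smith_field_def by (intro tendsto_intros assms)

text \<open>By \<open>2 * r \<le> 1 + r\<^sup>2\<close> every switching rate is controlled by the
  disequilibrium. This gives the dominating function when passing to the limit in the regularised
  equations.\<close>

lemma abs_smith_field_le:
  fixes x :: "real ^ 'n::finite"
  assumes "\<And>k. x $ k \<ge> 0" "\<And>k. x $ k \<le> 1"
  shows "\<bar>smith_field C x k\<bar> \<le> CARD('n) * (1 + disequilibrium C x)"
proof -
  have *: "0 \<le> x $ k * max 0 (C k - C l) \<and> 2 * (x $ k * max 0 (C k - C l)) \<le> 1 + disequilibrium C x" for k l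
  proof -
    have "2 * (x $ k * max 0 (C k - C l)) \<le> x $ k + x $ k * (max 0 (C k - C l))\<^sup>2"
      using mult_left_mono[OF sum_squares_bound[of 1 "max 0 (C k - C l)"], of "x $ k"] assms
      by (simp add: algebra_simps)
    then show ?thesis
      using mult_excess_square_le_disequilibrium[of x k C l] assms by (smt (verit) max.cobounded1 mult_nonneg_nonneg)
  qed
  have "(\<Sum>l\<in>(UNIV::'n set). x $ l * max 0 (C l - C k)) \<le> of_nat CARD('n) * ((1 + disequilibrium C x) / 2)"
    using * by (intro sum_bounded_above) (auto simp: field_simps)
  moreover have "(\<Sum>l\<in>(UNIV::'n set). x $ k * max 0 (C k - C l)) \<le> of_nat CARD('n) * ((1 + disequilibrium C x) / 2)"
    using * by (intro sum_bounded_above) (auto simp: field_simps)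
  moreover have "(\<Sum>l\<in>UNIV. x $ l * max 0 (C l - C k)) \<ge> 0" "(\<Sum>l\<in>UNIV. x $ k * max 0 (C k - C l)) \<ge> 0"
    using * by (auto intro!: sum_nonneg)
  ultimately show ?thesis
    unfolding smith_field_def abs_le_iff by (simp add: field_simps)
qed

section \<open>Differential equations with bounded Lipschitz right-hand side\<close>

lemma integral_has_vector_derivative_atLeast:
  fixes f :: "real \<Rightarrow> 'a::banach"
  assumes "continuous_on {a..} f" "a \<le> t"
  shows "((\<lambda>u. integral {a..u} f) has_vector_derivative f t) (at t within {a..})"
proof -
  have "((\<lambda>u. integral {a..u} f) has_vector_derivative f t) (at t within {a..t + 1})"
    using assms by (intro integral_has_vector_derivative) (auto intro: continuous_on_subset)
  moreover have "at t within {a..t + 1} = at t within {a..}"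
    by (rule at_within_nhd[of _ "{..<t + 1}"]) auto
  ultimately show ?thesis by simp
qed

text \<open>The Picard operator becomes a contraction on bounded functions once the solution is damped
  by \<open>exp (- 2 K t)\<close>.\<close>

lemma bounded_lipschitz_ode_solution:
  fixes F :: "'a::euclidean_space \<Rightarrow> 'a"
  assumes lip: "L-lipschitz_on UNIV F" and bdd: "bounded (range F)"
  shows "\<exists>x. x 0 = x0 \<and> continuous_on {0..} x \<and> (\<forall>t>0. (x has_vector_derivative F (x t)) (at t))"
proof -
  \<comment> \<open>\<open>K \<ge> 1\<close> ensures \<open>t \<le> exp (2 * K * t)\<close>, so that
    the damping tames the linear growth of the integral.\<close>
  define K where "K = max L 1"
  have K: "K \<ge> 1" "K-lipschitz_on UNIV F"
    using lip by (auto simp: K_def intro: lipschitz_on_le)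
  obtain B where B: "\<And>x. norm (F x) \<le> B"
    using bdd by (auto simp: bounded_iff)
  have contF: "continuous_on UNIV F"
    using lip by (rule lipschitz_on_continuous_on)
  \<comment> \<open>The unknown \<open>y\<close> is the damped solution; \<open>G\<close> undoes the
    damping before applying the field, and \<open>P\<close> is the damped Picard operator.\<close>
  define G where "G y s = F (exp (2 * K * s) *\<^sub>R apply_bcontfun y s)" for y s
  define P where "P y t = exp (- (2 * K * t)) *\<^sub>R (x0 + integral {0..t} (G y))" for y t
  have contG: "continuous_on A (G y)" for y A
    unfolding G_def by (intro continuous_intros continuous_on_compose2[OF contF]) auto
  have intG: "G y integrable_on {0..t}" for y t
    by (intro integrable_continuous_real contG)
  have indef: "continuous_on {0..} (\<lambda>t. integral {0..t} (G y))" for y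
    unfolding continuous_on_eq_continuous_within
    using integral_has_vector_derivative_atLeast[OF contG] has_vector_derivative_continuous
    by (metis atLeast_iff)
  have contP: "continuous_on {0..} (P y)" for y
    unfolding P_def using indef by (intro continuous_intros)
  have boundP: "norm (P y t) \<le> norm x0 + B" if "t \<ge> 0" for y t
  proof -
    have "norm (integral {0..t} (G y)) \<le> B * t"
      using integral_bound[OF that contG, of y B] B unfolding G_def by simp
    moreover have "t \<le> exp (2 * K * t)"
      using exp_ge_add_one_self[of "2 * K * t"] mult_right_mono[OF K(1) that] that by linarith
    moreover have "B \<ge> 0"
      using B[of x0] norm_ge_zero[of "F x0"] by linarith
    ultimately have "norm (integral {0..t} (G y)) \<le> B * exp (2 * K * t)"
      using mult_left_mono[of t "exp (2 * K * t)" B] by linarith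
    moreover have "norm x0 \<le> norm x0 * exp (2 * K * t)"
      using that K mult_left_mono[of 1 "exp (2 * K * t)" "norm x0"] by simp
    ultimately have "norm (x0 + integral {0..t} (G y)) \<le> (norm x0 + B) * exp (2 * K * t)"
      using norm_triangle_ineq[of x0 "integral {0..t} (G y)"]
      unfolding distrib_right by linarith
    moreover have "norm (P y t) = norm (x0 + integral {0..t} (G y)) / exp (2 * K * t)"
      by (simp add: P_def exp_minus divide_inverse_commute)
    ultimately show ?thesis
      by (simp add: divide_le_eq)
  qed
  \<comment> \<open>Bounded continuous functions live on the whole line, so values at negative times
    are frozen at the value at time 0.\<close>
  define \<Phi> where "\<Phi> y = Bcontfun (\<lambda>t. P y (max 0 t))" for y
  have apply_\<Phi>: "apply_bcontfun (\<Phi> y) t = P y (max 0 t)" for y t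
    unfolding \<Phi>_def using boundP
    by (subst Bcontfun_inverse)
      (auto intro!: bcontfun_normI[where b = "norm x0 + B"] continuous_on_compose2[OF contP]
        continuous_intros)
  have "dist (\<Phi> y) (\<Phi> y') \<le> 1 / 2 * dist y y'" for y y'
  proof (rule dist_bound)
    fix u :: real
    define t where "t = max 0 u"
    have t: "t \<ge> 0" by (simp add: t_def)
    \<comment> \<open>Twice the Lipschitz constant in the exponent gives the contraction factor 1/2:
      integrating \<open>K * exp (2 * K * s)\<close> produces at most half of the exponential that
      the damping cancels.\<close>
    have exp_int: "((\<lambda>s. K * (exp (2 * K * s) * dist y y')) has_integral
        exp (2 * K * t) * dist y y' / 2 - exp (2 * K * 0) * dist y y' / 2) {0..t}"
      using t K by (intro fundamental_theorem_of_calculus)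
        (auto intro!: derivative_eq_intros simp: has_real_derivative_iff_has_vector_derivative[symmetric])
    have "norm (G y s - G y' s) \<le> K * (exp (2 * K * s) * dist y y')" for s
    proof -
      have "norm (G y s - G y' s) \<le> K * dist (exp (2 * K * s) *\<^sub>R apply_bcontfun y s) (exp (2 * K * s) *\<^sub>R apply_bcontfun y' s)"
        unfolding G_def dist_norm[symmetric] by (rule lipschitz_onD[OF K(2)]) auto
      also have "\<dots> = K * (exp (2 * K * s) * dist (apply_bcontfun y s) (apply_bcontfun y' s))"
        by (simp add: dist_norm scaleR_diff_right[symmetric])
      also have "\<dots> \<le> K * (exp (2 * K * s) * dist y y')"
        using K by (intro mult_left_mono dist_bounded) auto
      finally show ?thesis .
    qed
    then have "norm (integral {0..t} (\<lambda>s. G y s - G y' s))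
        \<le> integral {0..t} (\<lambda>s. K * (exp (2 * K * s) * dist y y'))"
      using exp_int by (intro integral_norm_bound_integral integrable_diff intG) auto
    also have "\<dots> \<le> exp (2 * K * t) * (1 / 2 * dist y y')"
      using integral_unique[OF exp_int] by simp
    finally have "norm (integral {0..t} (G y) - integral {0..t} (G y')) \<le> exp (2 * K * t) * (1 / 2 * dist y y')"
      by (simp add: integral_diff intG)
    moreover have "P y t - P y' t = exp (- (2 * K * t)) *\<^sub>R (integral {0..t} (G y) - integral {0..t} (G y'))"
      by (simp add: P_def scaleR_add_right scaleR_diff_right)
    then have "norm (P y t - P y' t) = norm (integral {0..t} (G y) - integral {0..t} (G y')) / exp (2 * K * t)"
      by (simp add: exp_minus divide_inverse_commute)
    ultimately have "norm (P y t - P y' t) \<le> 1 / 2 * dist y y'"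
      by (simp add: divide_le_eq mult.commute)
    then show "dist (apply_bcontfun (\<Phi> y) u) (apply_bcontfun (\<Phi> y') u) \<le> 1 / 2 * dist y y'"
      by (simp add: apply_\<Phi> dist_norm t_def)
  qed
  then obtain y where y: "\<Phi> y = y"
    using ex1_implies_ex[OF banach_fix_type[of "1 / 2" \<Phi>]] by auto
  define x where "x t = x0 + integral {0..t} (G y)" for t
  have "exp (2 * K * t) *\<^sub>R apply_bcontfun y t = x t" if "t \<ge> 0" for t
    using apply_\<Phi>[of y t] that by (simp add: y P_def x_def exp_minus)
  then have Gx: "G y t = F (x t)" if "t \<ge> 0" for t
    using that by (simp add: G_def)
  have "(x has_vector_derivative F (x t)) (at t within {0..})" if "t \<ge> 0" for t
    using has_vector_derivative_add[OF has_vector_derivative_const[of x0]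
        integral_has_vector_derivative_atLeast[OF contG that, of y]]
    unfolding x_def[abs_def] by (simp add: Gx[OF that, unfolded x_def])
  moreover have "at t within {0..} = at t" if "t > 0" for t :: real
    using that by (intro at_within_interior) simp
  ultimately have deriv: "(x has_vector_derivative F (x t)) (at t)" if "t > 0" for t
    using that by (metis order.strict_implies_order)
  have "continuous_on {0..} x"
    unfolding x_def[abs_def] using indef by (intro continuous_intros)
  then show ?thesis
    using deriv by (intro exI[of _ x]) (simp add: x_def[of 0])
qed

section \<open>Calculus of bounded Lipschitz functions\<close>

definition bounded_lipschitz :: "('a::metric_space \<Rightarrow> 'b::real_normed_vector) \<Rightarrow> bool" where
  "bounded_lipschitz f \<longleftrightarrow>
     (\<exists>B L. (\<forall>x. norm (f x) \<le> B) \<and> (\<forall>x y. dist (f x) (f y) \<le> L * dist x y) \<and> 0 \<le> L)"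

lemma bounded_lipschitzI:
  assumes "\<And>x. norm (f x) \<le> B" "\<And>x y. dist (f x) (f y) \<le> L * dist x y" "0 \<le> L"
  shows "bounded_lipschitz f"
  using assms unfolding bounded_lipschitz_def by blast

named_theorems bounded_lipschitz_intros

lemma bounded_lipschitz_const [bounded_lipschitz_intros]: "bounded_lipschitz (\<lambda>x. c)"
  by (rule bounded_lipschitzI[of _ "norm c" 0]) auto

lemma bounded_lipschitz_add [bounded_lipschitz_intros]:
  assumes "bounded_lipschitz f" "bounded_lipschitz g"
  shows "bounded_lipschitz (\<lambda>x. f x + g x)"
proof -
  obtain B L where f: "\<And>x. norm (f x) \<le> B" "\<And>x y. dist (f x) (f y) \<le> L * dist x y" "0 \<le> L"
    using assms(1) unfolding bounded_lipschitz_def by blast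
  obtain B' L' where g: "\<And>x. norm (g x) \<le> B'" "\<And>x y. dist (g x) (g y) \<le> L' * dist x y" "0 \<le> L'"
    using assms(2) unfolding bounded_lipschitz_def by blast
  show ?thesis
  proof (rule bounded_lipschitzI)
    show "norm (f x + g x) \<le> B + B'" for x
      using f(1)[of x] g(1)[of x] norm_triangle_ineq[of "f x" "g x"] by linarith
    show "dist (f x + g x) (f y + g y) \<le> (L + L') * dist x y" for x y
      using f(2)[of x y] g(2)[of x y] dist_triangle_add[of "f x" "g x" "f y" "g y"]
      by (simp add: distrib_right)
  qed (use f g in auto)
qed

text \<open>The bounds pay off here: the product rule multiplies each Lipschitz constant by a bound
  of the other factor. Carrying both properties together closes the class under the operations of
  the vector field.\<close>

lemma bounded_lipschitz_mult [bounded_lipschitz_intros]: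
  fixes f g :: "'a::metric_space \<Rightarrow> real"
  assumes "bounded_lipschitz f" "bounded_lipschitz g"
  shows "bounded_lipschitz (\<lambda>x. f x * g x)"
proof -
  obtain B L where f: "\<And>x. norm (f x) \<le> B" "\<And>x y. dist (f x) (f y) \<le> L * dist x y" "0 \<le> L"
    using assms(1) unfolding bounded_lipschitz_def by blast
  obtain B' L' where g: "\<And>x. norm (g x) \<le> B'" "\<And>x y. dist (g x) (g y) \<le> L' * dist x y" "0 \<le> L'"
    using assms(2) unfolding bounded_lipschitz_def by blast
  have B: "0 \<le> B"
    using order_trans[OF norm_ge_zero f(1)] .
  show ?thesis
  proof (rule bounded_lipschitzI)
    show "norm (f x * g x) \<le> B * B'" for x
      using f(1)[of x] g(1)[of x] B by (simp add: abs_mult mult_mono)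
    show "dist (f x * g x) (f y * g y) \<le> (B * L' + L * B') * dist x y" for x y
    proof -
      have "\<bar>f x * (g x - g y)\<bar> \<le> B * (L' * dist x y)"
        unfolding abs_mult using f(1)[of x] g(2)[of x y] B
        by (intro mult_mono) (auto simp: dist_real_def)
      moreover have "\<bar>(f x - f y) * g y\<bar> \<le> (L * dist x y) * B'"
        unfolding abs_mult using f(2)[of x y] g(1)[of y] f(3)
        by (intro mult_mono) (auto simp: dist_real_def)
      moreover have "f x * g x - f y * g y = f x * (g x - g y) + (f x - f y) * g y"
        by (simp add: algebra_simps)
      ultimately show ?thesis
        unfolding dist_real_def by (simp add: algebra_simps)
    qed
    have "0 \<le> B'"
      using order_trans[OF norm_ge_zero g(1)] .
    then show "0 \<le> B * L' + L * B'"
      using B f(3) g(3) by simp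
  qed
qed

lemma bounded_lipschitz_minus [bounded_lipschitz_intros]:
  "bounded_lipschitz f \<Longrightarrow> bounded_lipschitz (\<lambda>x. - f x)"
  unfolding bounded_lipschitz_def by (simp add: dist_minus)

lemma bounded_lipschitz_diff [bounded_lipschitz_intros]:
  "bounded_lipschitz f \<Longrightarrow> bounded_lipschitz g \<Longrightarrow> bounded_lipschitz (\<lambda>x. f x - g x)"
  using bounded_lipschitz_add[OF _ bounded_lipschitz_minus, of f g] by simp

lemma bounded_lipschitz_sum [bounded_lipschitz_intros]:
  "(\<And>i. i \<in> A \<Longrightarrow> bounded_lipschitz (f i)) \<Longrightarrow> bounded_lipschitz (\<lambda>x. \<Sum>i\<in>A. f i x)"
  by (induction A rule: infinite_finite_induct) (auto intro: bounded_lipschitz_intros)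

lemma bounded_lipschitz_max [bounded_lipschitz_intros]:
  fixes f :: "'a::metric_space \<Rightarrow> real"
  assumes "bounded_lipschitz f"
  shows "bounded_lipschitz (\<lambda>x. max c (f x))"
proof -
  obtain B L where f: "\<And>x. norm (f x) \<le> B" "\<And>x y. dist (f x) (f y) \<le> L * dist x y" "0 \<le> L"
    using assms unfolding bounded_lipschitz_def by blast
  show ?thesis
  proof (rule bounded_lipschitzI)
    show "norm (max c (f x)) \<le> \<bar>c\<bar> + B" for x
      using f(1)[of x] by auto
    show "dist (max c (f x)) (max c (f y)) \<le> L * dist x y" for x y
      using f(2)[of x y] by (auto simp: dist_real_def)
  qed fact
qed

text \<open>The positive lower bound on the denominator is what the regularisation \<open>e\<close>
  will supply.\<close>

lemma bounded_lipschitz_inverse: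
  fixes f :: "'a::metric_space \<Rightarrow> real"
  assumes "bounded_lipschitz f" "c > 0" "\<And>x. f x \<ge> c"
  shows "bounded_lipschitz (\<lambda>x. inverse (f x))"
proof -
  obtain B L where f: "\<And>x. norm (f x) \<le> B" "\<And>x y. dist (f x) (f y) \<le> L * dist x y" "0 \<le> L"
    using assms(1) unfolding bounded_lipschitz_def by blast
  show ?thesis
  proof (rule bounded_lipschitzI)
    have pos: "f x > 0" "inverse (f x) \<le> inverse c" for x
      using assms(2) assms(3)[of x] by (auto intro: le_imp_inverse_le)
    show "norm (inverse (f x)) \<le> inverse c" for x
      using pos[of x] by simp
    show "dist (inverse (f x)) (inverse (f y)) \<le> (inverse c * inverse c * L) * dist x y" for x y
    proof -
      have "dist (inverse (f x)) (inverse (f y)) = inverse (f x) * inverse (f y) * \<bar>f x - f y\<bar>"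
        using pos[of x] pos[of y] by (simp add: dist_real_def inverse_diff_inverse abs_mult)
      also have "\<dots> \<le> (inverse c * inverse c) * (L * dist x y)"
        using pos[of x] pos[of y] f(2)[of x y] assms(2)
        by (intro mult_mono) (auto simp: dist_real_def)
      finally show ?thesis by (simp add: mult_ac)
    qed
    show "0 \<le> inverse c * inverse c * L" using f assms by simp
  qed
qed

text \<open>A bare coordinate is unbounded; the clamped one agrees with it on flows.\<close>

lemma bounded_lipschitz_clamped_nth [bounded_lipschitz_intros]:
  "bounded_lipschitz (\<lambda>x::real ^ 'n. max 0 (min 1 (x $ k)))"
proof (rule bounded_lipschitzI)
  show "norm (max 0 (min 1 (x $ k))) \<le> 1" for x :: "real ^ 'n" by simp
  show "dist (max 0 (min 1 (x $ k))) (max 0 (min 1 (y $ k))) \<le> 1 * dist x y" for x y :: "real ^ 'n"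
    using dist_vec_nth_le[of x k y] by (auto simp: dist_real_def)
qed simp

lemma bounded_lipschitz_vec:
  fixes f :: "'a::metric_space \<Rightarrow> real ^ 'n"
  assumes "\<And>k. bounded_lipschitz (\<lambda>x. f x $ k)"
  shows "bounded_lipschitz f"
proof -
  have "\<forall>k. \<exists>B L. (\<forall>x. norm (f x $ k) \<le> B) \<and> (\<forall>x y. dist (f x $ k) (f y $ k) \<le> L * dist x y) \<and> 0 \<le> L"
    using assms unfolding bounded_lipschitz_def by blast
  then obtain B L where BL: "\<And>k x. norm (f x $ k) \<le> B k"
      "\<And>k x y. dist (f x $ k) (f y $ k) \<le> L k * dist x y" "\<And>k. 0 \<le> L k"
    by metis
  show ?thesis
  proof (rule bounded_lipschitzI)
    show "norm (f x) \<le> sum B UNIV" for x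
      unfolding norm_vec_def
      by (rule L2_set_le_sum[THEN order_trans]) (use BL(1) in \<open>auto intro!: sum_mono\<close>)
    show "dist (f x) (f y) \<le> sum L UNIV * dist x y" for x y
      unfolding dist_vec_def sum_distrib_right
      by (rule L2_set_le_sum[THEN order_trans]) (auto intro!: sum_mono BL)
  qed (auto intro: sum_nonneg BL)
qed

text \<open>Arzela-Ascoli on a half-line in pointwise form: a diagonal subsequence converges at
  rational times, and equicontinuity extends this to all times and makes the limit
  continuous.\<close>

lemma equicontinuous_convergent_subsequence:
  fixes X :: "nat \<Rightarrow> real \<Rightarrow> 'a::euclidean_space"
  assumes bounded: "\<And>n t. t \<ge> 0 \<Longrightarrow> norm (X n t) \<le> M"
    and equicontinuous: "\<And>e. e > 0 \<Longrightarrow>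
      \<exists>d>0. \<forall>n s t. s \<ge> 0 \<and> t \<ge> 0 \<and> \<bar>s - t\<bar> < d \<longrightarrow> dist (X n s) (X n t) < e"
  obtains k x where "strict_mono (k :: nat \<Rightarrow> nat)" "\<And>t. t \<ge> 0 \<Longrightarrow> (\<lambda>n. X (k n) t) \<longlonglongrightarrow> x t"
    "continuous_on {0..} x"
proof -
  obtain k where k: "strict_mono (k :: nat \<Rightarrow> nat)"
    "\<And>t. t \<in> \<rat> \<inter> {0..} \<Longrightarrow> \<exists>l. (\<lambda>n. X (k n) t) \<longlonglongrightarrow> l"
  proof (rule function_convergent_subsequence[of "\<rat> \<inter> {0..}" X M])
    show "countable (\<rat> \<inter> {0::real..})"
      using countable_rat by blast
    show "norm (X n t) \<le> M" if "t \<in> \<rat> \<inter> {0..}" for n t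
      using that bounded by simp
  qed (rule that)
  have "\<exists>l. (\<lambda>n. X (k n) t) \<longlonglongrightarrow> l" if t: "t \<ge> 0" for t
  proof -
    have "Cauchy (\<lambda>n. X (k n) t)"
    proof (rule metric_CauchyI)
      fix e :: real assume "e > 0"
      then obtain d where d: "d > 0"
        "\<And>n s t. s \<ge> 0 \<Longrightarrow> t \<ge> 0 \<Longrightarrow> \<bar>s - t\<bar> < d \<Longrightarrow> dist (X n s) (X n t) < e / 3"
        using equicontinuous[of "e / 3"] by auto
      \<comment> \<open>A rational to the right of \<open>t\<close> lies in the half-line even if
        \<open>t = 0\<close>.\<close>
      obtain q where q: "q \<in> \<rat>" "t < q" "q < t + d"
        using Rats_dense_in_real[of t "t + d"] d by auto
      then have "convergent (\<lambda>n. X (k n) q)"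
        using k(2)[of q] t by (auto simp: convergent_def)
      then obtain M where M: "\<And>m n. m \<ge> M \<Longrightarrow> n \<ge> M \<Longrightarrow> dist (X (k m) q) (X (k n) q) < e / 3"
        using metric_CauchyD[OF convergent_Cauchy, of _ "e / 3"] \<open>e > 0\<close>
        by (metis divide_pos_pos zero_less_numeral)
      show "\<exists>M. \<forall>m\<ge>M. \<forall>n\<ge>M. dist (X (k m) t) (X (k n) t) < e"
      proof (intro exI[of _ M] allI impI)
        fix m n assume "m \<ge> M" "n \<ge> M"
        moreover have "dist (X (k m) t) (X (k m) q) < e / 3" "dist (X (k n) q) (X (k n) t) < e / 3"
          using q t by (intro d; simp)+
        ultimately show "dist (X (k m) t) (X (k n) t) < e"
          using M[of m n] dist_triangle[of "X (k m) t" "X (k n) t" "X (k m) q"]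
            dist_triangle[of "X (k m) q" "X (k n) t" "X (k n) q"] by linarith
      qed
    qed
    then show ?thesis
      using Cauchy_convergent by (auto simp: convergent_def)
  qed
  then obtain x where x: "\<And>t. t \<ge> 0 \<Longrightarrow> (\<lambda>n. X (k n) t) \<longlonglongrightarrow> x t"
    by metis
  have "continuous_on {0..} x"
    unfolding continuous_on_iff
  proof (intro ballI allI impI)
    fix t e :: real assume "t \<in> {0..}" "e > 0"
    obtain d where d: "d > 0"
      "\<And>n s t. s \<ge> 0 \<Longrightarrow> t \<ge> 0 \<Longrightarrow> \<bar>s - t\<bar> < d \<Longrightarrow> dist (X n s) (X n t) < e / 2"
      using equicontinuous[of "e / 2"] \<open>e > 0\<close> by auto
    have "dist (x s) (x t) \<le> e / 2" if "s \<ge> 0" "\<bar>s - t\<bar> < d" for s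
    proof (rule LIMSEQ_le_const2)
      show "(\<lambda>n. dist (X (k n) s) (X (k n) t)) \<longlonglongrightarrow> dist (x s) (x t)"
        using that \<open>t \<in> {0..}\<close> by (intro tendsto_intros x) auto
      show "\<exists>N. \<forall>n\<ge>N. dist (X (k n) s) (X (k n) t) \<le> e / 2"
        using that \<open>t \<in> {0..}\<close> d(2)[of s t] by (intro exI[of _ 0]) (simp add: less_imp_le)
    qed
    then have "dist (x s) (x t) < e" if "s \<ge> 0" "\<bar>s - t\<bar> < d" for s
      using that \<open>e > 0\<close> by fastforce
    then show "\<exists>d>0. \<forall>s\<in>{0..}. dist s t < d \<longrightarrow> dist (x s) (x t) < e"
      using d(1) by (intro exI[of _ d]) (auto simp: dist_real_def)
  qed
  then show ?thesis
    using that k(1) x by blast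
qed

section \<open>Perceived costs and their disequilibrium\<close>

lemma flowsD:
  assumes "x \<in> flows"
  shows "x $ k \<ge> 0" "x $ k \<le> 1" "(\<Sum>k\<in>UNIV. x $ k) = 1" "x $ 1 + x $ 2 + x $ 3 = 1"
proof -
  have *: "\<And>k. x $ k \<ge> 0" "(\<Sum>k\<in>UNIV. x $ k) = 1"
    using assms by (auto simp: flows_def)
  then show "x $ k \<ge> 0" "(\<Sum>k\<in>UNIV. x $ k) = 1" "x $ 1 + x $ 2 + x $ 3 = 1"
    by (auto simp: sum_3)
  show "x $ k \<le> 1"
    using member_le_sum[of k UNIV "($) x"] * by simp
qed

lemma flowsI: "(\<And>k. x $ k \<ge> 0) \<Longrightarrow> x $ 1 + x $ 2 + x $ 3 = 1 \<Longrightarrow> x \<in> flows"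
  by (auto simp: flows_def sum_3)

text \<open>Written through the ratio \<open>f t / g t\<close>, the derivative has the form that
  later completes to a square.\<close>

lemma has_real_derivative_square_quotient:
  fixes c :: real
  assumes "(f has_real_derivative f') (at t)" "(g has_real_derivative g') (at t)" "g t \<noteq> 0"
  shows "((\<lambda>s. c * (f s)\<^sup>2 / g s) has_real_derivative
     c * (2 * (f t / g t) * f' - (f t / g t)\<^sup>2 * g')) (at t)"
  using assms by (auto intro!: derivative_eq_intros simp: field_simps power2_eq_square)

locale optimal_network =
  fixes N :: network and z :: "real ^ 3"
  assumes valid: "valid_network N" and optimal: "optimal_flow N z"
begin

definition h :: real where "h = high_cost N / 2"

definition \<alpha> :: real where "\<alpha> = z $ 2 / z $ 1"

definition \<beta> :: real where "\<beta> = z $ 3 / z $ 1"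

text \<open>For \<open>e = 0\<close> this is the perceived cost under the side payments, off the faces where those
  are singular. A positive \<open>e\<close> removes the singularity and preserves the monotonicity of the
  costs.\<close>

definition cost :: "real \<Rightarrow> real ^ 3 \<Rightarrow> 3 \<Rightarrow> real" where
  "cost e x k =
     (if k = 1 then h * (\<alpha> + 2 * \<beta>) * x $ 1
      else if k = 2 then h * (1 + x $ 3 - \<alpha> * (x $ 1)\<^sup>2 / (x $ 2 + e))
      else h * (2 - x $ 2 - 2 * \<beta> * (x $ 1)\<^sup>2 / (x $ 3 + e)))"

lemma cost_simps:
  "cost e x 1 = h * (\<alpha> + 2 * \<beta>) * x $ 1"
  "cost e x 2 = h * (1 + x $ 3 - \<alpha> * (x $ 1)\<^sup>2 / (x $ 2 + e))"
  "cost e x 3 = h * (2 - x $ 2 - 2 * \<beta> * (x $ 1)\<^sup>2 / (x $ 3 + e))"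
  by (simp_all add: cost_def)

text \<open>A denominator matters only if its coefficient is nonzero; otherwise the whole fraction
  is 0.\<close>

definition nondegenerate :: "real \<Rightarrow> real ^ 3 \<Rightarrow> bool" where
  "nondegenerate e x \<longleftrightarrow> (\<alpha> = 0 \<or> x $ 2 + e > 0) \<and> (\<beta> = 0 \<or> x $ 3 + e > 0)"

abbreviation V :: "real \<Rightarrow> real ^ 3 \<Rightarrow> real" where
  "V e x \<equiv> disequilibrium (cost e x) x"

text \<open>Real-valued counterpart of \<open>trajectory\<close>, also for the regularised costs.
  Time 0 is exempt from nondegeneracy, as initial flows may be singular.\<close>

definition solution :: "real \<Rightarrow> (real \<Rightarrow> real ^ 3) \<Rightarrow> bool" where
  "solution e x \<longleftrightarrow> continuous_on {0..} x \<and> (\<forall>t\<ge>0. x t \<in> flows) \<and>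
     (\<forall>t>0. nondegenerate e (x t) \<and>
        (\<forall>k. ((\<lambda>s. x s $ k) has_real_derivative smith_field (cost e (x t)) (x t) k) (at t)))"

lemma h_pos: "h > 0"
  using valid by (simp add: h_def valid_network_def)

lemma z_flow: "z \<in> flows"
  using optimal by (simp add: optimal_flow_def)

lemma z_order: "z $ 2 \<le> z $ 1" "z $ 3 \<le> z $ 2"
proof -
  let ?y = "vector [z $ 2, z $ 1, z $ 3] :: real ^ 3"
  have "?y \<in> flows"
    using flowsD[OF z_flow] by (auto intro!: flowsI simp: forall_3[of "\<lambda>k. ?y $ k \<ge> 0", THEN iffD2, rule_format])
  then have "social_welfare N ?y \<le> social_welfare N z"
    using optimal by (simp add: optimal_flow_def)
  then show "z $ 2 \<le> z $ 1"
    using h_pos by (simp add: social_welfare_def total_content_def sum_3 travel_cost_def h_def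
        add_ac mult_le_cancel_left)
  let ?y = "vector [z $ 1, z $ 3, z $ 2] :: real ^ 3"
  have "?y \<in> flows"
    using flowsD[OF z_flow] by (auto intro!: flowsI simp: forall_3[of "\<lambda>k. ?y $ k \<ge> 0", THEN iffD2, rule_format])
  then have "social_welfare N ?y \<le> social_welfare N z"
    using optimal by (simp add: optimal_flow_def)
  then have "h * (2 * z $ 2 + z $ 3) \<ge> h * (2 * z $ 3 + z $ 2)"
    by (simp add: social_welfare_def total_content_def sum_3 travel_cost_def h_def algebra_simps)
  then show "z $ 3 \<le> z $ 2"
    using h_pos by simp
qed

lemma z1_pos: "z $ 1 > 0" and z1_ge: "z $ 1 \<ge> 1 / 3"
  using z_order flowsD(4)[OF z_flow] by linarith+

lemma z_eq: "z $ 2 = \<alpha> * z $ 1" "z $ 3 = \<beta> * z $ 1"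
  using z1_pos by (simp_all add: \<alpha>_def \<beta>_def)

lemma \<alpha>\<beta>: "0 \<le> \<beta>" "\<beta> \<le> \<alpha>" "\<alpha> \<le> 1" "0 \<le> \<alpha>" "\<beta> \<le> 1"
  using z_order z1_pos flowsD(1)[OF z_flow]
  by (auto simp: \<alpha>_def \<beta>_def divide_le_eq_1 divide_le_cancel)

lemma z_normalised: "z $ 1 * (1 + \<alpha> + \<beta>) = 1"
  using flowsD(4)[OF z_flow] by (simp add: z_eq algebra_simps)

lemma nondegenerate_z: "nondegenerate 0 z"
  using \<alpha>\<beta> z1_pos by (auto simp: nondegenerate_def z_eq zero_less_mult_iff less_le)

lemma nondegenerate_pos: "e > 0 \<Longrightarrow> x \<in> flows \<Longrightarrow> nondegenerate e x"
  using flowsD(1)[of x] by (simp add: nondegenerate_def add_nonneg_pos)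

lemma cost_tendsto:
  assumes "(X \<longlongrightarrow> x) F" "(E \<longlongrightarrow> e) F" "nondegenerate e x"
  shows "((\<lambda>n. cost (E n) (X n) k) \<longlongrightarrow> cost e x k) F"
proof -
  have "((\<lambda>n. \<alpha> * (X n $ 1)\<^sup>2 / (X n $ 2 + E n)) \<longlongrightarrow> \<alpha> * (x $ 1)\<^sup>2 / (x $ 2 + e)) F"
    using assms by (cases "\<alpha> = 0") (auto simp: nondegenerate_def intro!: tendsto_intros)
  moreover have "((\<lambda>n. 2 * \<beta> * (X n $ 1)\<^sup>2 / (X n $ 3 + E n)) \<longlongrightarrow> 2 * \<beta> * (x $ 1)\<^sup>2 / (x $ 3 + e)) F"
    using assms by (cases "\<beta> = 0") (auto simp: nondegenerate_def intro!: tendsto_intros)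
  ultimately show ?thesis
    unfolding cost_def by (auto intro!: tendsto_intros assms)
qed

lemma V_tendsto:
  assumes "(X \<longlongrightarrow> x) F" "(E \<longlongrightarrow> e) F" "nondegenerate e x"
  shows "((\<lambda>n. V (E n) (X n)) \<longlongrightarrow> V e x) F"
  using assms by (intro disequilibrium_tendsto cost_tendsto)

lemma V_continuous_on:
  assumes "continuous_on A x" "\<And>t. t \<in> A \<Longrightarrow> nondegenerate e (x t)"
  shows "continuous_on A (\<lambda>t. V e (x t))"
  using assms unfolding continuous_on_def by (auto intro!: V_tendsto)

lemma V_nonneg: "x \<in> flows \<Longrightarrow> V e x \<ge> 0"
  by (intro disequilibrium_nonneg flowsD)

text \<open>\<open>p\<close> and \<open>q\<close> stand for \<open>x $ 1 / (x $ 2 + e)\<close> and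
  \<open>x $ 1 / (x $ 3 + e)\<close>. They are free parameters because the quadratic form is
  nonnegative for all values of them.\<close>

definition cost_derivative :: "real \<Rightarrow> real \<Rightarrow> (3 \<Rightarrow> real) \<Rightarrow> 3 \<Rightarrow> real" where
  "cost_derivative p q v k =
     (if k = 1 then h * (\<alpha> + 2 * \<beta>) * v 1
      else if k = 2 then h * (v 3 - \<alpha> * (2 * p * v 1 - p\<^sup>2 * v 2))
      else h * (- v 2 - 2 * \<beta> * (2 * q * v 1 - q\<^sup>2 * v 3)))"

lemma cost_has_derivative:
  assumes "\<And>k. ((\<lambda>s. x s $ k) has_real_derivative x' k) (at t)" "nondegenerate e (x t)"
  defines "p \<equiv> x t $ 1 / (x t $ 2 + e)" and "q \<equiv> x t $ 1 / (x t $ 3 + e)"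
  shows "((\<lambda>s. cost e (x s) k) has_real_derivative cost_derivative p q x' k) (at t)"
proof -
  have p: "((\<lambda>s. \<alpha> * (x s $ 1)\<^sup>2 / (x s $ 2 + e)) has_real_derivative
      \<alpha> * (2 * p * x' 1 - p\<^sup>2 * x' 2)) (at t)"
  proof (cases "\<alpha> = 0")
    case False
    then have "x t $ 2 + e \<noteq> 0"
      using assms(2) by (auto simp: nondegenerate_def)
    then show ?thesis
      unfolding p_def
      using has_real_derivative_square_quotient[OF assms(1) DERIV_add[OF assms(1) DERIV_const],
          of 2 e \<alpha> 1]
      by simp
  qed simp
  have q: "((\<lambda>s. 2 * \<beta> * (x s $ 1)\<^sup>2 / (x s $ 3 + e)) has_real_derivative
      2 * \<beta> * (2 * q * x' 1 - q\<^sup>2 * x' 3)) (at t)"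
  proof (cases "\<beta> = 0")
    case False
    then have "x t $ 3 + e \<noteq> 0"
      using assms(2) by (auto simp: nondegenerate_def)
    then show ?thesis
      unfolding q_def
      using has_real_derivative_square_quotient[OF assms(1) DERIV_add[OF assms(1) DERIV_const],
          of 3 e "2 * \<beta>" 1]
      by simp
  qed simp
  define P where "P s = \<alpha> * (x s $ 1)\<^sup>2 / (x s $ 2 + e)" for s
  define Q where "Q s = 2 * \<beta> * (x s $ 1)\<^sup>2 / (x s $ 3 + e)" for s
  note p = p[folded P_def] and q = q[folded Q_def]
  show ?thesis
    unfolding cost_def cost_derivative_def P_def[symmetric] Q_def[symmetric]
    by (auto intro!: derivative_eq_intros assms(1) p q)
qed

text \<open>The contributions \<open>v 3\<close> to the second cost and \<open>- v 2\<close> to the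
  third are antisymmetric and cancel; the rest completes to weighted squares.\<close>

lemma cost_monotone:
  assumes "v 1 + v 2 + v 3 = 0"
  shows "(\<Sum>k\<in>UNIV. cost_derivative p q v k * v k) \<ge> 0"
proof -
  have "0 \<le> h * (\<alpha> * (v 1 - p * v 2)\<^sup>2 + 2 * \<beta> * (v 1 - q * v 3)\<^sup>2)"
    using h_pos \<alpha>\<beta> by simp
  then show ?thesis
    by (simp add: cost_derivative_def sum_3 power2_eq_square algebra_simps)
qed

section \<open>Decay of the disequilibrium along solutions\<close>

lemma V_has_derivative:
  assumes "solution e x" "t > 0"
  shows "\<exists>D. ((\<lambda>s. V e (x s)) has_real_derivative D) (at t) \<and>
     D \<le> - (\<Sum>k\<in>UNIV. \<Sum>l\<in>UNIV. x t $ k * max 0 (cost e (x t) k - cost e (x t) l) ^ 3)"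
proof (rule disequilibrium_has_derivative)
  let ?v = "smith_field (cost e (x t)) (x t)"
  let ?p = "x t $ 1 / (x t $ 2 + e)" and ?q = "x t $ 1 / (x t $ 3 + e)"
  have xt: "x t \<in> flows" "nondegenerate e (x t)"
    "\<And>k. ((\<lambda>s. x s $ k) has_real_derivative ?v k) (at t)"
    using assms by (auto simp: solution_def)
  show "((\<lambda>s. x s $ k) has_real_derivative ?v k) (at t)" for k
    by (rule xt)
  show "x t $ k \<ge> 0" for k
    using xt flowsD by blast
  show "((\<lambda>s. cost e (x s) k) has_real_derivative cost_derivative ?p ?q ?v k) (at t)" for k
    by (rule cost_has_derivative[OF xt(3,2)])
  show "(\<Sum>k\<in>UNIV. cost_derivative ?p ?q ?v k * ?v k) \<ge> 0"
    using sum_smith_field[of "cost e (x t)" "x t"] unfolding sum_3[of "smith_field _ _"]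
    by (rule cost_monotone)
qed

text \<open>\<open>V_decay\<close> gives no useful bound shortly after the starting time, whereas
  stability needs control from there on.\<close>

lemma V_nonincreasing:
  assumes "solution e x" "0 \<le> s" "s \<le> t" "nondegenerate e (x s)"
  shows "V e (x t) \<le> V e (x s)"
proof (rule DERIV_nonpos_imp_decreasing_open[where f = "\<lambda>u. V e (x u)"])
  fix u assume u: "s < u"
  then have "x u $ k \<ge> 0" for k
    using assms flowsD(1) by (auto simp: solution_def)
  then have "(\<Sum>k\<in>UNIV. \<Sum>l\<in>UNIV. x u $ k * max 0 (cost e (x u) k - cost e (x u) l) ^ 3) \<ge> 0"
    by (intro sum_nonneg) auto
  then show "\<exists>D. ((\<lambda>s. V e (x s)) has_real_derivative D) (at u) \<and> D \<le> 0"
    using V_has_derivative[OF assms(1), of u] u assms(2) by (meson neg_le_0_iff_le order.trans le_less_trans)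
next
  have "nondegenerate e (x u)" if "u \<in> {s..t}" for u
    using that assms by (cases "u = s") (auto simp: solution_def)
  moreover have "continuous_on {s..t} x"
    using assms by (auto simp: solution_def intro: continuous_on_subset)
  ultimately show "continuous_on {s..t} (\<lambda>t. V e (x t))"
    by (intro V_continuous_on)
qed (fact assms)

text \<open>The tangent inequality for the cubes, with slope chosen as \<open>2 / (t - s)\<close>, makes
  \<open>(t - s) ^ 3 * V\<close> grow at most at rate 12.\<close>

lemma V_decay:
  assumes sol: "solution e x" and st: "0 \<le> s" "s < t" and nd: "nondegenerate e (x s)"
  shows "V e (x t) \<le> 12 / (t - s)\<^sup>2"
proof -
  define f where "f u = (u - s) ^ 3 * V e (x u) - 12 * (u - s)" for u
  have "f t \<le> f s"
  proof (rule DERIV_nonpos_imp_decreasing_open[where f = f])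
    fix u assume u: "s < u" "u < t"
    obtain D where D: "((\<lambda>s. V e (x s)) has_real_derivative D) (at u)"
        "D \<le> - (\<Sum>k\<in>UNIV. \<Sum>l\<in>UNIV. x u $ k * max 0 (cost e (x u) k - cost e (x u) l) ^ 3)"
      using V_has_derivative[OF sol, of u] u st by auto
    have xu: "x u \<in> flows"
      using sol u st by (simp add: solution_def)
    have "D \<le> - (3 / 2 * (2 / (u - s)) * V e (x u) - 3 * (2 / (u - s)) ^ 3 / 2)"
      using D(2) sum_excess_cube_ge[of "x u" "2 / (u - s)" "cost e (x u)"] flowsD[OF xu] u by simp
    then have "(u - s) ^ 3 * D \<le> (u - s) ^ 3 * - (3 / 2 * (2 / (u - s)) * V e (x u) - 3 * (2 / (u - s)) ^ 3 / 2)"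
      using u by (intro mult_left_mono) auto
    moreover have "w ^ 3 * - (3 / 2 * (2 / w) * r - 3 * (2 / w) ^ 3 / 2) = 12 - 3 * w\<^sup>2 * r"
      if "w \<noteq> 0" for w r :: real
      using that by (simp add: field_simps power3_eq_cube power2_eq_square)
    ultimately have "(u - s) ^ 3 * D \<le> 12 - 3 * (u - s)\<^sup>2 * V e (x u)"
      using u by (metis diff_gt_0_iff_gt less_irrefl)
    then have "3 * (u - s)\<^sup>2 * V e (x u) + (u - s) ^ 3 * D - 12 \<le> 0"
      by linarith
    moreover have "(f has_real_derivative 3 * (u - s)\<^sup>2 * V e (x u) + (u - s) ^ 3 * D - 12) (at u)"
      unfolding f_def[abs_def] by (auto intro!: derivative_eq_intros D(1))
    ultimately show "\<exists>y. (f has_real_derivative y) (at u) \<and> y \<le> 0"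
      by blast
  next
    have "nondegenerate e (x u)" if "u \<in> {s..t}" for u
      using that assms by (cases "u = s") (auto simp: solution_def)
    moreover have "continuous_on {s..t} x"
      using assms by (auto simp: solution_def intro: continuous_on_subset)
    ultimately show "continuous_on {s..t} f"
      unfolding f_def[abs_def] by (intro continuous_intros V_continuous_on)
  qed (use st in simp)
  then have "(t - s) * ((t - s)\<^sup>2 * V e (x t)) \<le> (t - s) * 12"
    by (simp add: f_def power3_eq_cube power2_eq_square mult_ac)
  then have "(t - s)\<^sup>2 * V e (x t) \<le> 12"
    using st by (subst (asm) mult_le_cancel_left_pos) auto
  then show ?thesis
    using st by (simp add: field_simps)
qed

text \<open>With \<open>d = \<alpha> * x $ 1 - x $ 2\<close> and
  \<open>f = \<beta> * x $ 1 - x $ 3\<close>, the gap between the mean costs weighted by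
  \<open>x\<close> and by \<open>z\<close> is
  \<open>z $ 1 * h * (d\<^sup>2 / x $ 2 + 2 * f\<^sup>2 / x $ 3)\<close>. It is at most the mean
  excess, and small \<open>d\<close> and \<open>f\<close> force \<open>x\<close> near
  \<open>z\<close> because both have total mass 1.\<close>

lemma dist_square_le:
  assumes x: "x \<in> flows" and nd: "nondegenerate 0 x"
  shows "(dist x z)\<^sup>2 \<le>
    216 / h * (\<Sum>k\<in>UNIV. \<Sum>l\<in>UNIV. x $ k * max 0 (cost 0 x k - cost 0 x l))"
    (is "_ \<le> 216 / h * ?R")
proof -
  note [simp] = z_eq
  define P where "P = \<alpha> * (x $ 1)\<^sup>2 / x $ 2"
  define Q where "Q = \<beta> * (x $ 1)\<^sup>2 / x $ 3"
  define d where "d = \<alpha> * x $ 1 - x $ 2"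
  define f where "f = \<beta> * x $ 1 - x $ 3"
  have x1: "x $ 1 = 1 - x $ 2 - x $ 3"
    using flowsD(4)[OF x] by simp
  \<comment> \<open>The right-hand side is \<open>(c * u - y)\<^sup>2 / y\<close>, and dividing by
    \<open>y \<le> 1\<close> does not decrease a square.\<close>
  have square_le: "(c * u - y)\<^sup>2 \<le> c * (c * u\<^sup>2 / y) - 2 * c * u + y"
    if "0 \<le> y" "y \<le> 1" "c = 0 \<or> y > 0" for c u y :: real
  proof (cases "c = 0")
    case True
    then show ?thesis
      using that mult_left_le[of y y] by (simp add: power2_eq_square)
  next
    case False
    then have "c * (c * u\<^sup>2 / y) - 2 * c * u + y = (c * u - y)\<^sup>2 / y"
      using that by (simp add: field_simps power2_eq_square)
    also have "\<dots> \<ge> (c * u - y)\<^sup>2"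
      using that False by (simp add: le_divide_eq mult_left_le)
    finally show ?thesis .
  qed
  have C: "cost 0 x 2 = h * (1 + x $ 3 - P)" "cost 0 x 3 = h * (2 - x $ 2 - 2 * Q)"
    by (simp_all add: cost_simps P_def Q_def)
  have xP: "x $ 2 * P = \<alpha> * (x $ 1)\<^sup>2" "x $ 3 * Q = \<beta> * (x $ 1)\<^sup>2"
    using nd by (auto simp: nondegenerate_def P_def Q_def)
  \<comment> \<open>Budget balance: the payments cancel in the mean cost and leave the mean travel
    cost.\<close>
  have "(\<Sum>k\<in>UNIV. x $ k * cost 0 x k) =
      h * ((\<alpha> + 2 * \<beta>) * (x $ 1)\<^sup>2 + x $ 2 - x $ 2 * P + 2 * x $ 3 - 2 * (x $ 3 * Q))"
    by (simp add: sum_3 C cost_simps(1) power2_eq_square algebra_simps)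
  also have "\<dots> = h * (x $ 2 + 2 * x $ 3)"
    unfolding xP by (simp add: algebra_simps)
  \<comment> \<open>The factor \<open>z $ 1 * (1 + \<alpha> + \<beta>) = 1\<close> is inserted so
    that both mean costs are multiples of \<open>z $ 1\<close>.\<close>
  finally have xC: "(\<Sum>k\<in>UNIV. x $ k * cost 0 x k) = z $ 1 * (1 + \<alpha> + \<beta>) * (h * (x $ 2 + 2 * x $ 3))"
    using z_normalised by simp
  have "(\<Sum>k\<in>UNIV. x $ k * cost 0 x k) - (\<Sum>l\<in>UNIV. z $ l * cost 0 x l) =
      z $ 1 * h * ((\<alpha> * P - 2 * \<alpha> * x $ 1 + x $ 2) + 2 * (\<beta> * Q - 2 * \<beta> * x $ 1 + x $ 3))"
    unfolding xC by (simp add: sum_3 C cost_simps(1) x1 algebra_simps)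
  also have "\<dots> \<ge> z $ 1 * h * (d\<^sup>2 + 2 * f\<^sup>2)"
    using h_pos z1_pos square_le[of "x $ 2" \<alpha> "x $ 1"] square_le[of "x $ 3" \<beta> "x $ 1"] nd flowsD[OF x]
    by (intro mult_left_mono add_mono) (auto simp: nondegenerate_def P_def Q_def d_def f_def)
  finally have "z $ 1 * h * (d\<^sup>2 + 2 * f\<^sup>2) \<le> (\<Sum>k\<in>UNIV. x $ k * cost 0 x k) - (\<Sum>l\<in>UNIV. z $ l * cost 0 x l)" .
  also have "\<dots> = (\<Sum>k\<in>UNIV. \<Sum>l\<in>UNIV. x $ k * z $ l * (cost 0 x k - cost 0 x l))"
  proof -
    have "(\<Sum>k\<in>UNIV. \<Sum>l\<in>UNIV. x $ k * z $ l * (cost 0 x k - cost 0 x l)) =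
        (\<Sum>k\<in>UNIV. x $ k * cost 0 x k) * (\<Sum>l\<in>UNIV. z $ l)
        - (\<Sum>k\<in>UNIV. x $ k) * (\<Sum>l\<in>UNIV. z $ l * cost 0 x l)"
      unfolding sum_product sum_subtractf[symmetric] by (intro sum.cong refl) (simp add: algebra_simps)
    then show ?thesis
      using flowsD(3)[OF x] flowsD(3)[OF z_flow] by simp
  qed
  also have "\<dots> \<le> ?R"
  proof (intro sum_mono)
    fix k l
    \<comment> \<open>Negative differences are dropped, and positive ones lose their weight
      \<open>z $ l \<le> 1\<close>.\<close>
    have "z $ l * (cost 0 x k - cost 0 x l) \<le> max 0 (cost 0 x k - cost 0 x l)"
      using flowsD(1,2)[OF z_flow, of l]
      by (cases "cost 0 x k \<ge> cost 0 x l") (auto simp: mult_left_le_one_le mult_nonneg_nonpos)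
    then show "x $ k * z $ l * (cost 0 x k - cost 0 x l) \<le> x $ k * max 0 (cost 0 x k - cost 0 x l)"
      using flowsD(1)[OF x] by (simp add: mult.assoc mult_left_mono)
  qed
  finally have W: "z $ 1 * h * (d\<^sup>2 + 2 * f\<^sup>2) \<le> ?R" .
  have "h / 3 * (d\<^sup>2 + f\<^sup>2) \<le> z $ 1 * h * (d\<^sup>2 + 2 * f\<^sup>2)"
    using z1_ge h_pos by (intro mult_mono) auto
  with W have df: "d\<^sup>2 + f\<^sup>2 \<le> 3 / h * ?R"
    using h_pos by (simp add: field_simps)
  have "x $ 1 - z $ 1 = z $ 1 * ((1 + \<alpha> + \<beta>) * x $ 1 - 1)"
    unfolding right_diff_distrib mult.assoc[symmetric] z_normalised by simp
  also have "(1 + \<alpha> + \<beta>) * x $ 1 - 1 = d + f"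
    using flowsD(4)[OF x] by (simp add: d_def f_def algebra_simps)
  finally have diff1: "x $ 1 - z $ 1 = z $ 1 * (d + f)" .
  have "\<bar>x $ 1 - z $ 1\<bar> \<le> 1 * (\<bar>d\<bar> + \<bar>f\<bar>)"
    unfolding diff1 abs_mult using flowsD(1,2)[OF z_flow, of 1] by (intro mult_mono) auto
  then have n1: "\<bar>x $ 1 - z $ 1\<bar> \<le> \<bar>d\<bar> + \<bar>f\<bar>"
    by simp
  have scaled: "\<bar>c * (x $ 1 - z $ 1)\<bar> \<le> \<bar>d\<bar> + \<bar>f\<bar>" if "0 \<le> c" "c \<le> 1" for c
    using that n1 mult_left_le_one_le[of "\<bar>x $ 1 - z $ 1\<bar>" c] by (simp add: abs_mult)
  have "x $ 2 - z $ 2 = \<alpha> * (x $ 1 - z $ 1) - d" "x $ 3 - z $ 3 = \<beta> * (x $ 1 - z $ 1) - f"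
    by (simp_all add: d_def f_def algebra_simps)
  then have n23: "\<bar>x $ 2 - z $ 2\<bar> \<le> 2 * \<bar>d\<bar> + \<bar>f\<bar>" "\<bar>x $ 3 - z $ 3\<bar> \<le> \<bar>d\<bar> + 2 * \<bar>f\<bar>"
    using scaled[of \<alpha>] scaled[of \<beta>] \<alpha>\<beta> by linarith+
  have "dist x z \<le> \<bar>x $ 1 - z $ 1\<bar> + \<bar>x $ 2 - z $ 2\<bar> + \<bar>x $ 3 - z $ 3\<bar>"
    using norm_le_l1_cart[of "x - z"] by (simp add: dist_norm sum_3)
  also have "\<dots> \<le> 6 * (\<bar>d\<bar> + \<bar>f\<bar>)"
    using n1 n23 by (smt (verit))
  \<comment> \<open>The constant is 216 = 72 * 3: here 72 = 2 * 36 comes from squaring, and the 3 in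
    \<open>df\<close> comes from \<open>z $ 1 \<ge> 1 / 3\<close>.\<close>
  finally have "(dist x z)\<^sup>2 \<le> (6 * (\<bar>d\<bar> + \<bar>f\<bar>))\<^sup>2"
    by (intro power_mono) auto
  also have "\<dots> \<le> 72 * (d\<^sup>2 + f\<^sup>2)"
    using sum_squares_bound[of "\<bar>d\<bar>" "\<bar>f\<bar>"] by (simp add: power2_eq_square algebra_simps)
  also have "\<dots> \<le> 72 * (3 / h * ?R)"
    using df by simp
  finally show ?thesis by simp
qed

lemma dist_le_V:
  assumes x: "x \<in> flows" and nd: "nondegenerate 0 x"
  shows "dist x z \<le> sqrt (216 / h * sqrt (3 * V 0 x))"
proof -
  let ?R = "\<Sum>k\<in>UNIV. \<Sum>l\<in>UNIV. x $ k * max 0 (cost 0 x k - cost 0 x l)"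
  have "?R\<^sup>2 \<le> 3 * V 0 x"
    using sum_excess_square_le[of x "cost 0 x"] flowsD[OF x] by simp
  then have "?R \<le> sqrt (3 * V 0 x)"
    by (rule real_le_rsqrt)
  then have "(dist x z)\<^sup>2 \<le> 216 / h * sqrt (3 * V 0 x)"
    using dist_square_le[OF assms] h_pos by (meson mult_left_mono order_trans divide_nonneg_pos zero_le_numeral)
  then show ?thesis
    by (rule real_le_rsqrt)
qed

text \<open>When \<open>P\<^sub>3\<close> is empty and has nothing to refund, the convention \<open>0 / 0 = 0\<close> replaces the limit
  value of the payment by 0. This does not affect the switching rates, as \<open>P\<^sub>3\<close> is then at least as
  costly as the other paths for both values.\<close>

definition real_perceived_cost :: "real ^ 3 \<Rightarrow> 3 \<Rightarrow> real" where
  "real_perceived_cost x k = (if k = 3 \<and> x $ 3 = 0 then 2 * h else cost 0 x k)"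

text \<open>At these flows all payments are finite. Besides the nondegenerate flows they include all
  those with \<open>x $ 1 = 0\<close>, where a singular quotient reads
  \<open>0 / 0 = 0\<close>.\<close>

definition regular :: "real ^ 3 \<Rightarrow> bool" where
  "regular x \<longleftrightarrow> (\<alpha> = 0 \<or> x $ 2 > 0 \<or> x $ 1 = 0) \<and> (\<beta> = 0 \<or> x $ 3 > 0 \<or> x $ 1 = 0)"

section \<open>Side payments evaluated in the extended reals\<close>

lemma travel_cost_simps: "travel_cost N 1 = 0" "travel_cost N 2 = h" "travel_cost N 3 = 2 * h"
  by (simp_all add: travel_cost_def h_def)

lemma one_minus: "x \<in> flows \<Longrightarrow> 1 - x $ 2 - x $ 3 = x $ 1"
  using flowsD(4)[of x] by simp

lemma side_payment1_eq:
  assumes "x \<in> flows"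
  shows "side_payment1 N z x = ereal (h * (\<alpha> + 2 * \<beta>) * x $ 1)"
  using z1_pos unfolding side_payment1_def one_minus[OF assms] one_minus[OF z_flow] travel_cost_simps
  by (simp add: z_eq field_simps)

lemma side_payment2_eq:
  assumes "x \<in> flows" "\<alpha> = 0 \<or> x $ 2 > 0 \<or> x $ 1 = 0"
  shows "side_payment2 N z x = ereal (h * (x $ 3 - \<alpha> * (x $ 1)\<^sup>2 / x $ 2))"
proof (cases "x $ 2 = 0")
  case True
  \<comment> \<open>On an empty second path the numerator vanishes too, and \<open>0 / 0\<close> is
    0 in \<open>ereal\<close> as well as in \<open>real\<close>.\<close>
  then have "(x $ 1)\<^sup>2 * z $ 2 * h = 0"
    using assms(2) by (auto simp: z_eq)
  then show ?thesis
    using True unfolding side_payment2_def one_minus[OF assms(1)] one_minus[OF z_flow] travel_cost_simps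
    by (simp add: divide_ereal_def algebra_simps)
next
  case False
  then show ?thesis
    using z1_pos unfolding side_payment2_def one_minus[OF assms(1)] one_minus[OF z_flow] travel_cost_simps
    by (simp add: z_eq field_simps)
qed

lemma side_payment2_singular:
  assumes "x \<in> flows" "\<alpha> > 0" "x $ 2 = 0" "x $ 1 > 0"
  shows "side_payment2 N z x = - \<infinity>"
proof -
  have "z $ 2 > 0"
    using assms z1_pos by (simp add: z_eq)
  then show ?thesis
    using assms h_pos
    unfolding side_payment2_def one_minus[OF assms(1)] one_minus[OF z_flow] travel_cost_simps
    by (simp add: divide_ereal_def)
qed

lemma payments_simps:
  "side_payments N z x 1 = side_payment1 N z x"
  "side_payments N z x 2 = side_payment2 N z x"
  "side_payments N z x 3 =
     - (ereal (x $ 1) * side_payment1 N z x + ereal (x $ 2) * side_payment2 N z x) / ereal (x $ 3)"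
  by (simp_all add: side_payments_def budget_balanced_payments_def)

text \<open>Of the money paid on the first path, \<open>h * \<alpha> * (x $ 1)\<^sup>2\<close> goes
  to the second path, whose users pay in \<open>h * x $ 2 * x $ 3\<close>. The balance is left to
  refund on the third path.\<close>

lemma collected_money:
  assumes "x \<in> flows" "\<alpha> = 0 \<or> x $ 2 > 0 \<or> x $ 1 = 0"
  shows "ereal (x $ 1) * side_payment1 N z x + ereal (x $ 2) * side_payment2 N z x =
    ereal (h * (2 * \<beta> * (x $ 1)\<^sup>2 + x $ 2 * x $ 3))"
proof -
  define E where "E = \<alpha> * (x $ 1)\<^sup>2 / x $ 2"
  have "x $ 2 * E = \<alpha> * (x $ 1)\<^sup>2"
    using assms(2) by (auto simp: E_def)
  moreover have "x $ 1 * (h * (\<alpha> + 2 * \<beta>) * x $ 1) + x $ 2 * (h * (x $ 3 - E)) =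
      h * ((\<alpha> + 2 * \<beta>) * (x $ 1)\<^sup>2 + x $ 2 * x $ 3 - x $ 2 * E)"
    by (simp add: algebra_simps power2_eq_square)
  ultimately have "x $ 1 * (h * (\<alpha> + 2 * \<beta>) * x $ 1) + x $ 2 * (h * (x $ 3 - E)) =
      h * (2 * \<beta> * (x $ 1)\<^sup>2 + x $ 2 * x $ 3)"
    by (simp add: algebra_simps)
  then show ?thesis
    unfolding side_payment1_eq[OF assms(1)] side_payment2_eq[OF assms] E_def by simp
qed

lemma perceived_cost_eq:
  assumes "x \<in> flows" "regular x"
  shows "perceived_cost N (side_payments N z) x k = ereal (real_perceived_cost x k)"
proof -
  have x2: "\<alpha> = 0 \<or> x $ 2 > 0 \<or> x $ 1 = 0"
    using assms(2) by (simp add: regular_def)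
  consider "k = 1" | "k = 2" | "k = 3" "x $ 3 = 0" | "k = 3" "x $ 3 \<noteq> 0"
    using exhaust_3 by blast
  then show ?thesis
  proof cases
    case 1
    then show ?thesis
      by (simp add: perceived_cost_def real_perceived_cost_def payments_simps travel_cost_simps
          cost_simps side_payment1_eq[OF assms(1)])
  next
    case 2
    then show ?thesis
      by (simp add: perceived_cost_def real_perceived_cost_def payments_simps travel_cost_simps
          cost_simps side_payment2_eq[OF assms(1) x2] algebra_simps)
  next
    case 3
    then have "h * (2 * \<beta> * (x $ 1)\<^sup>2 + x $ 2 * x $ 3) = 0"
      using assms(2) by (auto simp: regular_def)
    then show ?thesis
      using 3 by (simp add: perceived_cost_def real_perceived_cost_def payments_simps
          travel_cost_simps collected_money[OF assms(1) x2] divide_ereal_def)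
  next
    case 4
    then show ?thesis
      unfolding perceived_cost_def 4(1) payments_simps collected_money[OF assms(1) x2]
      by (simp add: real_perceived_cost_def travel_cost_simps cost_simps field_simps)
  qed
qed

lemma switch_rate_eq:
  assumes "x \<in> flows" "regular x"
  shows "switch_rate N (side_payments N z) x k l = ereal (x $ k * max 0 (cost 0 x k - cost 0 x l))"
proof -
  have "x $ k * max 0 (real_perceived_cost x k - real_perceived_cost x l) =
      x $ k * max 0 (cost 0 x k - cost 0 x l)"
  \<comment> \<open>The two values differ in effect only for switches into an empty third path. Both
    are then at least \<open>h\<close>, while the other paths cost at most \<open>h\<close>, so the
    rate is 0 either way.\<close>
  proof (cases "l = 3 \<and> k \<noteq> 3 \<and> x $ 3 = 0")
    case True
    have le: "cost 0 x 3 \<le> 2 * h"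
      using True h_pos flowsD(1)[OF assms(1)] by (simp add: cost_simps)
    have "\<beta> * (x $ 1)\<^sup>2 = 0"
      using True assms(2) by (auto simp: regular_def)
    then have "cost 0 x 3 = h * (2 - x $ 2)"
      by (simp add: cost_simps)
    moreover have "\<beta> * x $ 1 = 0"
      using True assms(2) by (auto simp: regular_def)
    then have "cost 0 x 1 \<le> h * 1"
      unfolding cost_simps mult.assoc distrib_right using h_pos \<alpha>\<beta> flowsD[OF assms(1)]
      by (intro mult_left_mono) (auto intro!: mult_le_one)
    moreover have "cost 0 x 2 \<le> h * 1"
      unfolding cost_simps using h_pos \<alpha>\<beta> flowsD[OF assms(1)] True
      by (intro mult_left_mono) auto
    moreover have "h * 1 \<le> h * (2 - x $ 2)"
      using h_pos flowsD[OF assms(1)] by (intro mult_left_mono) auto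
    ultimately have "cost 0 x k \<le> cost 0 x 3"
      using exhaust_3[of k] True by auto
    then show ?thesis
      using True le by (simp add: real_perceived_cost_def)
  qed (auto simp: real_perceived_cost_def)
  moreover have max_ereal: "max 0 (ereal a - ereal b) = ereal (max 0 (a - b))" for a b
    by (simp add: zero_ereal_def max_def)
  ultimately show ?thesis
    unfolding switch_rate_def perceived_cost_eq[OF assms] max_ereal times_ereal.simps(1) by (simp only:)
qed

lemma smith_field_ereal:
  assumes "x \<in> flows" "regular x"
  shows "(\<Sum>l\<in>UNIV. switch_rate N (side_payments N z) x l k) -
      (\<Sum>l\<in>UNIV. switch_rate N (side_payments N z) x k l) = ereal (smith_field (cost 0 x) x k)"
  by (simp add: switch_rate_eq[OF assms] smith_field_def)

text \<open>With \<open>x $ 1 = 0\<close> the first path is free and both others cost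
  \<open>h * (1 + x $ 3)\<close>, so all users move towards it.\<close>

lemma smith_field_pos_at_empty_first:
  assumes "x \<in> flows" "x $ 1 = 0"
  shows "smith_field (cost 0 x) x 1 > 0"
proof -
  have x: "x $ 2 \<ge> 0" "x $ 3 \<ge> 0" "x $ 2 + x $ 3 = 1"
    using flowsD[OF assms(1)] assms(2) by auto
  have pos: "1 + x $ 3 > 0" "2 - x $ 2 > 0"
    using x by auto
  have "smith_field (cost 0 x) x 1 = x $ 2 * (h * (1 + x $ 3)) + x $ 3 * (h * (2 - x $ 2))"
    using h_pos pos assms(2) by (simp add: smith_field_def sum_3 cost_simps max_def mult_le_0_iff)
  also have "\<dots> = h * (1 + x $ 3)"
    using x(3) by (simp add: algebra_simps) (metis add.commute add_diff_cancel_left' distrib_left mult.right_neutral)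
  also have "\<dots> > 0"
    using h_pos pos by simp
  finally show ?thesis .
qed

text \<open>A real derivative must match the switching rates. An empty first path would be at a
  minimum, with derivative 0, despite its positive inflow; an empty path with an infinite subsidy
  would have infinite inflow from the first path.\<close>

lemma trajectory_pos:
  assumes tr: "trajectory N (side_payments N z) x" and t: "t > 0"
  shows "x t $ 1 > 0" "nondegenerate 0 (x t)"
proof -
  let ?g = "side_payments N z"
  have xt: "x t \<in> flows"
    using tr t by (simp add: trajectory_def)
  obtain v where v: "(x has_vector_derivative v) (at t)"
    "\<And>k. ereal (v $ k) = (\<Sum>l\<in>UNIV. switch_rate N ?g (x t) l k) - (\<Sum>l\<in>UNIV. switch_rate N ?g (x t) k l)"
    using tr t unfolding trajectory_def by blast
  have deriv: "((\<lambda>s. x s $ k) has_real_derivative v $ k) (at t)" for k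
    using bounded_linear.has_vector_derivative[OF bounded_linear_vec_nth v(1)]
    by (simp add: has_real_derivative_iff_has_vector_derivative)
  show x1: "x t $ 1 > 0"
  proof (rule ccontr)
    assume "\<not> ?thesis"
    then have x1: "x t $ 1 = 0"
      using flowsD(1)[OF xt, of 1] by simp
    have "v $ 1 = 0"
    proof (rule DERIV_local_min[OF deriv t])
      show "\<forall>y. \<bar>t - y\<bar> < t \<longrightarrow> x t $ 1 \<le> x y $ 1"
        using tr flowsD(1) x1 by (auto simp: trajectory_def)
    qed
    moreover have "ereal (v $ 1) = ereal (smith_field (cost 0 (x t)) (x t) 1)"
      unfolding v(2) using x1 by (intro smith_field_ereal xt) (simp add: regular_def)
    ultimately show False
      using smith_field_pos_at_empty_first[OF xt x1] by simp
  qed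
  have no_infinite_subsidy: "x t $ k > 0" if "perceived_cost N ?g (x t) k = - \<infinity>"
      "perceived_cost N ?g (x t) 1 = ereal c" for k c
  proof (rule ccontr)
    assume "\<not> ?thesis"
    then have xk: "x t $ k = 0"
      using flowsD(1)[OF xt, of k] by simp
    have "switch_rate N ?g (x t) 1 k = \<infinity>"
      using x1 that by (simp add: switch_rate_def)
    then have "(\<Sum>l\<in>UNIV. switch_rate N ?g (x t) l k) = \<infinity>"
      unfolding sum_Pinfty by auto
    moreover have "(\<Sum>l\<in>UNIV. switch_rate N ?g (x t) k l) = 0"
      by (simp add: switch_rate_def xk zero_ereal_def[symmetric])
    ultimately show False
      using v(2)[of k] by simp
  qed
  have cost1: "perceived_cost N ?g (x t) 1 = ereal (h * (\<alpha> + 2 * \<beta>) * x t $ 1)"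
    by (simp add: perceived_cost_def payments_simps travel_cost_simps side_payment1_eq[OF xt])
  have x2: "x t $ 2 > 0" if "\<alpha> \<noteq> 0"
  proof (rule ccontr)
    assume *: "\<not> ?thesis"
    then have "x t $ 2 = 0"
      using flowsD(1)[OF xt, of 2] by simp
    then have "perceived_cost N ?g (x t) 2 = - \<infinity>"
      using that \<alpha>\<beta> x1
      by (simp add: perceived_cost_def payments_simps side_payment2_singular[OF xt])
    then show False
      using no_infinite_subsidy[OF _ cost1] * by blast
  qed
  have x3: "x t $ 3 > 0" if "\<beta> \<noteq> 0"
  proof (rule ccontr)
    assume *: "\<not> ?thesis"
    then have x3: "x t $ 3 = 0"
      using flowsD(1)[OF xt, of 3] by simp
    \<comment> \<open>Since \<open>\<beta> \<le> \<alpha>\<close>, the second path is used as well,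
      so the money to be refunded on the empty third path is finite and positive.\<close>
    have "\<alpha> \<noteq> 0" "\<beta> > 0"
      using that \<alpha>\<beta> by linarith+
    then have "\<beta> * (h * (x t $ 1)\<^sup>2) > 0"
      using x1 h_pos by simp
    then have "perceived_cost N ?g (x t) 3 = - \<infinity>"
      using x1 x3 x2[OF \<open>\<alpha> \<noteq> 0\<close>] h_pos \<open>\<beta> > 0\<close>
      by (simp add: perceived_cost_def payments_simps collected_money[OF xt] divide_ereal_def
          zero_less_mult_iff mult_less_0_iff)
    then show False
      using no_infinite_subsidy[OF _ cost1] * by blast
  qed
  show "nondegenerate 0 (x t)"
    using x2 x3 by (auto simp: nondegenerate_def)
qed

lemma nondegenerate_imp_regular: "nondegenerate 0 x \<Longrightarrow> regular x"
  by (auto simp: nondegenerate_def regular_def)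

lemma trajectory_imp_solution:
  assumes tr: "trajectory N (side_payments N z) x"
  shows "solution 0 x"
proof -
  have "((\<lambda>s. x s $ k) has_real_derivative smith_field (cost 0 (x t)) (x t) k) (at t)" if t: "t > 0" for t k
  proof -
    have xt: "x t \<in> flows" "regular (x t)"
      using tr t trajectory_pos(2)[OF tr t] by (auto simp: trajectory_def intro: nondegenerate_imp_regular)
    obtain v where v: "(x has_vector_derivative v) (at t)"
      "\<And>k. ereal (v $ k) = ereal (smith_field (cost 0 (x t)) (x t) k)"
      using tr t smith_field_ereal[OF xt] unfolding trajectory_def by force
    then show ?thesis
      using bounded_linear.has_vector_derivative[OF bounded_linear_vec_nth v(1), of k]
      by (simp add: has_real_derivative_iff_has_vector_derivative)
  qed
  then show ?thesis
    using tr trajectory_pos(2)[OF tr] by (simp add: solution_def trajectory_def)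
qed

lemma solution_imp_trajectory:
  assumes "solution 0 x"
  shows "trajectory N (side_payments N z) x"
proof -
  have "\<exists>v. (x has_vector_derivative v) (at t) \<and>
      (\<forall>k. ereal (v $ k) = (\<Sum>l\<in>UNIV. switch_rate N (side_payments N z) (x t) l k)
        - (\<Sum>l\<in>UNIV. switch_rate N (side_payments N z) (x t) k l))" if t: "t > 0" for t
  proof -
    define v :: "real ^ 3" where "v = (\<chi> k. smith_field (cost 0 (x t)) (x t) k)"
    have "((\<lambda>s. x s $ k) has_vector_derivative v $ k) (at t)" for k
      using assms t by (simp add: solution_def v_def has_real_derivative_iff_has_vector_derivative)
    then have "(x has_vector_derivative v) (at t)"
      unfolding has_vector_derivative_def
      by (subst has_derivative_componentwise_within)
        (auto simp: Basis_vec_def inner_axis has_vector_derivative_def)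
    moreover have "x t \<in> flows" "regular (x t)"
      using assms t by (auto simp: solution_def intro: nondegenerate_imp_regular)
    ultimately show ?thesis
      using smith_field_ereal[of "x t"] by (intro exI[of _ v]) (simp add: v_def)
  qed
  then show ?thesis
    using assms by (simp add: trajectory_def solution_def)
qed

section \<open>Regularised solutions and their limits\<close>

text \<open>Clamping the coordinates makes the field bounded and Lipschitz on the whole space. The
  clamped equation keeps flows in the simplex, where clamping changes nothing.\<close>

lemma regularised_solution_exists:
  assumes e: "e > 0" and x0: "x0 \<in> flows"
  shows "\<exists>x. x 0 = x0 \<and> solution e x"
proof -
  define c where "c y = (\<chi> k. max 0 (min 1 (y $ k)))" for y :: "real ^ 3"
  define F where "F y = (\<chi> k. smith_field (cost e (c y)) (c y) k)" for y
  have c_nonneg: "c y $ k \<ge> 0" for y k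
    by (simp add: c_def)
  have bl_c: "bounded_lipschitz (\<lambda>y. c y $ k)" for k
    by (simp add: c_def bounded_lipschitz_clamped_nth)
  have "bounded_lipschitz (\<lambda>y. inverse (c y $ k + e))" for k
    using e c_nonneg by (intro bounded_lipschitz_inverse[of _ e] bounded_lipschitz_intros bl_c) auto
  then have "bounded_lipschitz (\<lambda>y. cost e (c y) k)" for k
    unfolding cost_def divide_inverse power2_eq_square
    using exhaust_3[of k] by (auto intro!: bounded_lipschitz_intros bl_c)
  then have "bounded_lipschitz F"
    unfolding F_def smith_field_def
    by (intro bounded_lipschitz_vec) (auto intro!: bounded_lipschitz_intros bl_c)
  then obtain B L where BL: "\<And>y. norm (F y) \<le> B" "\<And>x y. dist (F x) (F y) \<le> L * dist x y" "0 \<le> L"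
    unfolding bounded_lipschitz_def by blast
  have "L-lipschitz_on UNIV F"
    using BL by (auto intro: lipschitz_onI)
  moreover have "bounded (range F)"
    using BL(1) by (auto intro!: boundedI)
  ultimately obtain x where x: "x 0 = x0" "continuous_on {0..} x"
      "\<And>t. t > 0 \<Longrightarrow> (x has_vector_derivative F (x t)) (at t)"
    using bounded_lipschitz_ode_solution[of L F x0] by blast
  have deriv: "((\<lambda>s. x s $ k) has_real_derivative F (x t) $ k) (at t)" if "t > 0" for t k
    using bounded_linear.has_vector_derivative[OF bounded_linear_vec_nth x(3)[OF that]]
    by (simp add: has_real_derivative_iff_has_vector_derivative)
  have cont: "continuous_on {0..t} (\<lambda>s. x s $ k)" for t k
    using x(2) by (intro continuous_intros) (auto intro: continuous_on_subset)
  have flow: "x t \<in> flows" if t: "t \<ge> 0" for t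
  proof (cases "t = 0")
    case False
    have "(\<Sum>k\<in>UNIV. x t $ k) = (\<Sum>k\<in>UNIV. x 0 $ k)"
    proof (rule DERIV_isconst2[of 0 t])
      show "((\<lambda>s. \<Sum>k\<in>UNIV. x s $ k) has_real_derivative 0) (at u)" if "0 < u" for u :: real
      proof -
        have "((\<lambda>s. \<Sum>k\<in>UNIV. x s $ k) has_real_derivative (\<Sum>k\<in>UNIV. F (x u) $ k)) (at u)"
          by (intro DERIV_sum deriv that)
        then show ?thesis
          by (simp add: F_def sum_smith_field)
      qed
    qed (use t False in \<open>auto intro!: continuous_on_sum cont\<close>)
    moreover have "x t $ k \<ge> 0" for k
    proof -
      \<comment> \<open>The squared negative part cannot grow: where a coordinate is negative, its
        clamped mass is 0, so the path has inflow only.\<close>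
      have "(max 0 (- x t $ k))\<^sup>2 \<le> (max 0 (- x 0 $ k))\<^sup>2"
      proof (rule DERIV_nonpos_imp_decreasing_open[where f = "\<lambda>t. (max 0 (- x t $ k))\<^sup>2"])
        fix u :: real assume u: "0 < u"
        have "((\<lambda>t. (max 0 (- x t $ k))\<^sup>2) has_real_derivative 2 * max 0 (- x u $ k) * - (F (x u) $ k)) (at u)"
          by (rule DERIV_chain2[OF has_real_derivative_max_0_power2 DERIV_minus[OF deriv[OF u]]])
        moreover have "2 * max 0 (- x u $ k) * - (F (x u) $ k) \<le> 0"
        proof (cases "x u $ k \<ge> 0")
          case False
          then have "c (x u) $ k = 0"
            by (simp add: c_def)
          then have "F (x u) $ k \<ge> 0"
            by (auto simp: F_def smith_field_def c_nonneg intro!: sum_nonneg)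
          then show ?thesis
            by (simp add: mult_nonneg_nonpos)
        qed simp
        ultimately show "\<exists>y. ((\<lambda>t. (max 0 (- x t $ k))\<^sup>2) has_real_derivative y) (at u) \<and> y \<le> 0"
          by blast
      next
        show "continuous_on {0..t} (\<lambda>t. (max 0 (- x t $ k))\<^sup>2)"
          by (intro continuous_intros cont)
      qed fact
      then have "(max 0 (- x t $ k))\<^sup>2 \<le> 0"
        using x(1) flowsD(1)[OF x0, of k] by simp
      then show ?thesis
        by (simp split: if_splits add: max_def)
    qed
    ultimately show ?thesis
      using flowsD(3)[OF x0] x(1) by (simp add: flows_def)
  qed (use x(1) x0 in simp)
  have "c (x t) = x t" if "t \<ge> 0" for t
    using flowsD(1,2)[OF flow[OF that]] by (simp add: c_def vec_eq_iff)
  then have "((\<lambda>s. x s $ k) has_real_derivative smith_field (cost e (x t)) (x t) k) (at t)" if "t > 0" for t k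
    using deriv[OF that] that by (simp add: F_def)
  then show ?thesis
    using x(1,2) flow e nondegenerate_pos by (intro exI[of _ x]) (auto simp: solution_def)
qed

lemma cost_le:
  assumes "x \<in> flows" "e \<ge> 0"
  shows "cost e x k \<le> 3 * h"
proof -
  have "(\<alpha> + 2 * \<beta>) * x $ 1 \<le> 3 * 1"
    using \<alpha>\<beta> flowsD(1,2)[OF assms(1)] by (intro mult_mono) auto
  then have "h * ((\<alpha> + 2 * \<beta>) * x $ 1) \<le> h * 3"
    using h_pos by (intro mult_left_mono) auto
  moreover have "\<alpha> * (x $ 1)\<^sup>2 / (x $ 2 + e) \<ge> 0" "2 * \<beta> * (x $ 1)\<^sup>2 / (x $ 3 + e) \<ge> 0"
    using \<alpha>\<beta> assms flowsD(1)[OF assms(1)] by auto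
  then have "h * (1 + x $ 3 - \<alpha> * (x $ 1)\<^sup>2 / (x $ 2 + e)) \<le> h * 3"
    "h * (2 - x $ 2 - 2 * \<beta> * (x $ 1)\<^sup>2 / (x $ 3 + e)) \<le> h * 3"
    using h_pos flowsD(1,2)[OF assms(1)] by (auto intro!: mult_left_mono) (smt (verit))+
  ultimately show ?thesis
    by (simp add: cost_def mult_ac)
qed

text \<open>Multiplying by the mass removes the singularity: \<open>y / (y + e) \<le> 1\<close>
  makes the bounds independent of \<open>e\<close>.\<close>

lemma mult_cost_ge:
  assumes "x \<in> flows" "e > 0"
  shows "x $ 2 * cost e x 2 \<ge> h * (x $ 2 * (1 + x $ 3) - \<alpha> * (x $ 1)\<^sup>2)"
    "x $ 3 * cost e x 3 \<ge> h * (x $ 3 * (2 - x $ 2) - 2 * \<beta> * (x $ 1)\<^sup>2)"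
proof -
  have frac: "y * (a / (y + e)) \<le> a" if "y \<ge> 0" "a \<ge> 0" for a y
    using that assms(2) by (simp add: divide_le_eq mult_mono mult.commute[of y])
  have "h * (x $ 2 * (1 + x $ 3) - \<alpha> * (x $ 1)\<^sup>2) \<le> h * (x $ 2 * (1 + x $ 3) - x $ 2 * (\<alpha> * (x $ 1)\<^sup>2 / (x $ 2 + e)))"
    using \<alpha>\<beta> h_pos flowsD(1)[OF assms(1)] by (intro mult_left_mono diff_left_mono frac) auto
  then show "x $ 2 * cost e x 2 \<ge> h * (x $ 2 * (1 + x $ 3) - \<alpha> * (x $ 1)\<^sup>2)"
    by (simp only: cost_simps right_diff_distrib mult.left_commute)
  have "h * (x $ 3 * (2 - x $ 2) - 2 * \<beta> * (x $ 1)\<^sup>2) \<le> h * (x $ 3 * (2 - x $ 2) - x $ 3 * (2 * \<beta> * (x $ 1)\<^sup>2 / (x $ 3 + e)))"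
    using \<alpha>\<beta> h_pos flowsD(1)[OF assms(1)] by (intro mult_left_mono diff_left_mono frac) auto
  then show "x $ 3 * cost e x 3 \<ge> h * (x $ 3 * (2 - x $ 2) - 2 * \<beta> * (x $ 1)\<^sup>2)"
    by (simp only: cost_simps right_diff_distrib mult.left_commute)
qed

lemma cost1_nonneg: "x \<in> flows \<Longrightarrow> cost e x 1 \<ge> 0"
  using h_pos \<alpha>\<beta> flowsD(1)[of x 1] by (simp add: cost_simps)

lemma mult_cost_ge_const:
  assumes "x \<in> flows" "e > 0"
  shows "x $ k * cost e x k \<ge> - (2 * h)"
proof -
  have x1: "(x $ 1)\<^sup>2 \<le> 1"
    using flowsD(1,2)[OF assms(1)] by (simp add: power_le_one)
  have "\<alpha> * (x $ 1)\<^sup>2 \<le> 1" "2 * \<beta> * (x $ 1)\<^sup>2 \<le> 2"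
    using mult_mono[OF \<alpha>\<beta>(3) x1] mult_mono[OF \<alpha>\<beta>(5) x1] by auto
  moreover have "x $ 2 * (1 + x $ 3) \<ge> 0" "x $ 3 * (2 - x $ 2) \<ge> 0"
    using flowsD(1)[OF assms(1), of 2] flowsD(1)[OF assms(1), of 3] flowsD(2)[OF assms(1), of 2]
    by (auto intro!: mult_nonneg_nonneg)
  ultimately have "h * - 2 \<le> h * (x $ 2 * (1 + x $ 3) - \<alpha> * (x $ 1)\<^sup>2)"
    "h * - 2 \<le> h * (x $ 3 * (2 - x $ 2) - 2 * \<beta> * (x $ 1)\<^sup>2)"
    using h_pos by (intro mult_left_mono; linarith)+
  moreover have "x $ 1 * cost e x 1 \<ge> 0"
    using cost1_nonneg[OF assms(1)] flowsD(1)[OF assms(1)] by simp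
  ultimately show ?thesis
    using mult_cost_ge[OF assms] exhaust_3[of k] h_pos by auto
qed

text \<open>Multiplied by \<open>x $ k\<close>, an excess over path \<open>k\<close> is at most
  \<open>3 * h + 2 * h\<close>, by \<open>cost_le\<close> and \<open>mult_cost_ge_const\<close>.
  Differentiating the square doubles this to \<open>10 * h\<close>, uniformly in
  \<open>e\<close>.\<close>

lemma flow_square_growth:
  assumes sol: "solution e x" and e: "e > 0" and st: "0 \<le> s" "s \<le> t"
  shows "(x t $ k)\<^sup>2 \<le> (x s $ k)\<^sup>2 + 10 * h * (t - s)"
proof -
  define f where "f u = (x u $ k)\<^sup>2 - 10 * h * u" for u
  have "f t \<le> f s"
  proof (rule DERIV_nonpos_imp_decreasing_open[where f = f])
    fix u assume u: "s < u" "u < t"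
    then have xu: "x u \<in> flows"
      and deriv: "((\<lambda>s. x s $ k) has_real_derivative smith_field (cost e (x u)) (x u) k) (at u)"
      using sol st by (auto simp: solution_def)
    have "x u $ k * smith_field (cost e (x u)) (x u) k \<le> (\<Sum>l\<in>UNIV. x u $ l * (x u $ k * max 0 (cost e (x u) l - cost e (x u) k)))"
      using flowsD(1)[OF xu] unfolding smith_field_def right_diff_distrib sum_distrib_left
      by (simp add: mult.left_commute sum_nonneg)
    also have "\<dots> \<le> (\<Sum>l\<in>UNIV. x u $ l * (5 * h))"
    proof (intro sum_mono mult_left_mono)
      fix l
      have "x u $ k * cost e (x u) l \<le> 3 * h"
      proof (cases "cost e (x u) l \<ge> 0")
        case True
        then show ?thesis
          using cost_le[OF xu, of e l] e flowsD(1,2)[OF xu, of k] by (smt (verit) mult_left_le_one_le)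
      next
        case False
        then show ?thesis
          using h_pos flowsD(1)[OF xu, of k] by (smt (verit) mult_nonneg_nonpos)
      qed
      then show "x u $ k * max 0 (cost e (x u) l - cost e (x u) k) \<le> 5 * h"
        using mult_cost_ge_const[OF xu e, of k] h_pos by (simp add: max_def right_diff_distrib)
    qed (rule flowsD(1)[OF xu])
    also have "\<dots> = 5 * h"
      using flowsD(3)[OF xu] by (simp flip: sum_distrib_right)
    finally have "2 * (x u $ k * smith_field (cost e (x u)) (x u) k) - 10 * h \<le> 0"
      by simp
    moreover have "(f has_real_derivative 2 * (x u $ k * smith_field (cost e (x u)) (x u) k) - 10 * h) (at u)"
      unfolding f_def[abs_def] by (auto intro!: derivative_eq_intros deriv)
    ultimately show "\<exists>y. (f has_real_derivative y) (at u) \<and> y \<le> 0"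
      by blast
  next
    have "continuous_on {s..t} x"
      using sol st by (auto simp: solution_def intro: continuous_on_subset)
    then show "continuous_on {s..t} f"
      unfolding f_def[abs_def] by (intro continuous_intros)
  qed fact
  then show ?thesis
    by (simp add: f_def algebra_simps)
qed

text \<open>Growth of each component is bounded uniformly, and shrinking of one component is growth of the
  others.\<close>

lemma solution_equicontinuous:
  assumes sol: "solution e x" and e: "e > 0" and st: "0 \<le> s" "s \<le> t"
  shows "\<bar>x t $ k - x s $ k\<bar> \<le> 2 * sqrt (10 * h * (t - s))"
proof -
  define r where "r = sqrt (10 * h * (t - s))"
  have flow: "x s \<in> flows" "x t \<in> flows"
    using sol st by (auto simp: solution_def)
  have r: "r \<ge> 0" "r\<^sup>2 = 10 * h * (t - s)"
    using h_pos st by (auto simp: r_def)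
  have up: "x t $ k - x s $ k \<le> r" for k
  proof -
    have "(x t $ k)\<^sup>2 \<le> (x s $ k)\<^sup>2 + r\<^sup>2"
      using flow_square_growth[OF assms] r by simp
    also have "\<dots> \<le> (x s $ k + r)\<^sup>2"
      using r flowsD(1)[OF flow(1)] by (simp add: power2_eq_square algebra_simps)
    finally have "x t $ k \<le> x s $ k + r"
      by (rule power2_le_imp_le) (use r flowsD(1)[OF flow(1)] in simp)
    then show ?thesis by simp
  qed
  have "x s $ k - x t $ k \<le> 2 * r"
    using up[of 1] up[of 2] up[of 3] exhaust_3[of k] flowsD(4)[OF flow(1)] flowsD(4)[OF flow(2)] by auto
  then show ?thesis
    using up[of k] r by (simp add: r_def[symmetric] abs_le_iff)
qed

lemma V_le:
  assumes "solution e x" "e > 0" "t > 0"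
  shows "V e (x t) \<le> 12 / t\<^sup>2"
  using V_decay[OF assms(1), of 0 t] assms nondegenerate_pos by (simp add: solution_def)

text \<open>For small \<open>x $ 1\<close> the mass-weighted cost of the other paths is nearly at
  least \<open>h\<close>, which gives the inflow. Each outflow \<open>x $ 1 * r\<close> is at most
  \<open>sqrt (x $ 1 * v)\<close>, since \<open>x $ 1 * r\<^sup>2 \<le> v\<close>.\<close>

lemma smith_field_first_ge:
  assumes x: "x \<in> flows" and e: "e > 0" and V: "V e x \<le> v"
  shows "smith_field (cost e x) x 1 \<ge> h * (1 - 7 * x $ 1) - 2 * sqrt (x $ 1 * v)"
proof -
  have outflow: "x $ 1 * max 0 (cost e x 1 - cost e x l) \<le> sqrt (x $ 1 * v)" for l
  proof (rule real_le_rsqrt)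
    have "x $ 1 * (x $ 1 * (max 0 (cost e x 1 - cost e x l))\<^sup>2) \<le> x $ 1 * v"
      using mult_excess_square_le_disequilibrium[of x 1 "cost e x" l] flowsD(1)[OF x] V
      by (intro mult_left_mono) auto
    then show "(x $ 1 * max 0 (cost e x 1 - cost e x l))\<^sup>2 \<le> x $ 1 * v"
      by (simp add: power2_eq_square mult_ac)
  qed
  have sq: "(x $ 1)\<^sup>2 \<le> x $ 1"
    using flowsD(1,2)[OF x, of 1] by (simp add: power2_eq_square mult_left_le)
  have "x $ 2 * max 0 (cost e x 2 - cost e x 1) + x $ 3 * max 0 (cost e x 3 - cost e x 1)
      \<ge> x $ 2 * (cost e x 2 - cost e x 1) + x $ 3 * (cost e x 3 - cost e x 1)"
    using flowsD(1)[OF x] by (intro add_mono mult_left_mono) auto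
  moreover have "(x $ 2 + x $ 3) * cost e x 1 \<le> 3 * h * x $ 1"
  proof -
    have "cost e x 1 \<le> h * 3 * x $ 1"
      unfolding cost_simps using h_pos \<alpha>\<beta> flowsD(1)[OF x] by (intro mult_right_mono mult_left_mono) auto
    moreover have "(x $ 2 + x $ 3) * cost e x 1 \<le> cost e x 1"
      using cost1_nonneg[OF x] flowsD(4)[OF x] flowsD(1)[OF x, of 1] flowsD(1)[OF x, of 2] flowsD(1)[OF x, of 3]
      by (intro mult_left_le_one_le) auto
    ultimately show ?thesis by simp
  qed
  moreover have "h * (x $ 2 * (1 + x $ 3) - \<alpha> * (x $ 1)\<^sup>2) + h * (x $ 3 * (2 - x $ 2) - 2 * \<beta> * (x $ 1)\<^sup>2)
      \<ge> h * (1 - 4 * x $ 1)"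
  proof -
    have "(\<alpha> + 2 * \<beta>) * (x $ 1)\<^sup>2 \<le> 3 * x $ 1"
      using sq \<alpha>\<beta> by (intro mult_mono) auto
    then have "1 - 4 * x $ 1 \<le> x $ 2 * (1 + x $ 3) - \<alpha> * (x $ 1)\<^sup>2 + (x $ 3 * (2 - x $ 2) - 2 * \<beta> * (x $ 1)\<^sup>2)"
      using flowsD(4)[OF x] flowsD(1)[OF x, of 3] by (simp add: algebra_simps)
    then show ?thesis
      using h_pos by (simp flip: distrib_left)
  qed
  ultimately have "x $ 2 * max 0 (cost e x 2 - cost e x 1) + x $ 3 * max 0 (cost e x 3 - cost e x 1)
      \<ge> h * (1 - 7 * x $ 1)"
    using mult_cost_ge[OF x e] by (simp add: algebra_simps)
  then show ?thesis
    using outflow[of 2] outflow[of 3] by (simp add: smith_field_def sum_3)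
qed

text \<open>If \<open>x t $ 1\<close> were tiny, equicontinuity would keep it small on an interval
  before \<open>t\<close>. There it grows at rate at least \<open>h / 2\<close>, which already
  produces a definite mass.\<close>

lemma first_path_bounded_below:
  assumes t: "t > 0"
  shows "\<exists>\<mu>>0. \<forall>e>0. \<forall>x. solution e x \<longrightarrow> x t $ 1 \<ge> \<mu>"
proof -
  \<comment> \<open>\<open>\<eta>\<close> leaves an inflow of \<open>3 * h / 4\<close> and, as 3072
    = 48 * 64, a total outflow of at most \<open>h / 4\<close>; here \<open>48 / t\<^sup>2\<close>
    bounds the disequilibrium on \<open>{t / 2..t}\<close>. \<open>\<delta>\<close> limits the
    variation over the interval to \<open>\<eta> / 2\<close>.\<close>
  define \<eta> where "\<eta> = min (1 / 28) (h\<^sup>2 * t\<^sup>2 / 3072)"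
  define \<delta> where "\<delta> = min (t / 2) (\<eta>\<^sup>2 / (160 * h))"
  have \<eta>: "\<eta> > 0" "7 * \<eta> \<le> 1 / 4" "2 * sqrt (\<eta> * (48 / t\<^sup>2)) \<le> h / 4"
  proof -
    show "\<eta> > 0" "7 * \<eta> \<le> 1 / 4"
      using t h_pos by (auto simp: \<eta>_def)
    have "\<eta> * (48 / t\<^sup>2) \<le> h\<^sup>2 * t\<^sup>2 / 3072 * (48 / t\<^sup>2)"
      by (intro mult_right_mono) (auto simp: \<eta>_def)
    also have "\<dots> = (h / 8)\<^sup>2"
      using t by (simp add: power2_eq_square field_simps)
    finally have "sqrt (\<eta> * (48 / t\<^sup>2)) \<le> h / 8"
      using h_pos by (intro real_le_lsqrt) auto
    then show "2 * sqrt (\<eta> * (48 / t\<^sup>2)) \<le> h / 4"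
      by simp
  qed
  have \<delta>: "\<delta> > 0" "\<delta> \<le> t / 2" "2 * sqrt (10 * h * \<delta>) \<le> \<eta> / 2"
  proof -
    show "\<delta> > 0" "\<delta> \<le> t / 2"
      using t h_pos \<eta> by (auto simp: \<delta>_def)
    have "10 * h * \<delta> \<le> 10 * h * (\<eta>\<^sup>2 / (160 * h))"
      using h_pos by (intro mult_left_mono) (auto simp: \<delta>_def)
    also have "\<dots> = (\<eta> / 4)\<^sup>2"
      using h_pos by (simp add: power2_eq_square field_simps)
    finally have "sqrt (10 * h * \<delta>) \<le> \<eta> / 4"
      using \<eta> by (intro real_le_lsqrt) auto
    then show "2 * sqrt (10 * h * \<delta>) \<le> \<eta> / 2"
      by simp
  qed
  have "x t $ 1 \<ge> min (\<eta> / 2) (h * \<delta> / 2)" if e: "e > 0" and sol: "solution e x" for e x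
  proof (rule ccontr)
    assume "\<not> ?thesis"
    then have small: "x t $ 1 < \<eta> / 2" "x t $ 1 < h * \<delta> / 2"
      by auto
    have x1: "x u $ 1 \<le> \<eta>" if "t - \<delta> \<le> u" "u \<le> t" for u
    proof -
      have "\<bar>x t $ 1 - x u $ 1\<bar> \<le> 2 * sqrt (10 * h * (t - u))"
        using that \<delta> t by (intro solution_equicontinuous[OF sol e]) auto
      also have "\<dots> \<le> 2 * sqrt (10 * h * \<delta>)"
        using that h_pos by simp
      finally show ?thesis
        using small \<delta> by linarith
    qed
    define f where "f u = h / 2 * u - x u $ 1" for u
    have "f t \<le> f (t - \<delta>)"
    proof (rule DERIV_nonpos_imp_decreasing_open[where f = f])
      fix u assume u: "t - \<delta> < u" "u < t"
      then have u2: "u \<ge> t / 2" "u > 0"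
        using \<delta> t by auto
      have xu: "x u \<in> flows"
        and deriv: "((\<lambda>s. x s $ 1) has_real_derivative smith_field (cost e (x u)) (x u) 1) (at u)"
        using sol u2 by (auto simp: solution_def)
      have "(t / 2)\<^sup>2 \<le> u\<^sup>2"
        using u2 t by (intro power_mono) auto
      then have "12 / u\<^sup>2 \<le> 12 / (t / 2)\<^sup>2"
        using u2 t by (intro divide_left_mono) auto
      then have "V e (x u) \<le> 48 / t\<^sup>2"
        using V_le[OF sol e u2(2)] by (simp add: power_divide)
      then have "smith_field (cost e (x u)) (x u) 1 \<ge> h * (1 - 7 * x u $ 1) - 2 * sqrt (x u $ 1 * (48 / t\<^sup>2))"
        by (rule smith_field_first_ge[OF xu e])
      moreover have "sqrt (x u $ 1 * (48 / t\<^sup>2)) \<le> sqrt (\<eta> * (48 / t\<^sup>2))"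
        using x1[of u] u by (intro real_sqrt_le_mono mult_right_mono) auto
      moreover have "h * (1 - 7 * x u $ 1) \<ge> h * (3 / 4)"
        using x1[of u] u \<eta> h_pos by (intro mult_left_mono) auto
      ultimately have "h / 2 - smith_field (cost e (x u)) (x u) 1 \<le> 0"
        using \<eta>(3) by linarith
      moreover have "(f has_real_derivative h / 2 - smith_field (cost e (x u)) (x u) 1) (at u)"
        unfolding f_def[abs_def] by (auto intro!: derivative_eq_intros deriv)
      ultimately show "\<exists>y. (f has_real_derivative y) (at u) \<and> y \<le> 0"
        by blast
    next
      have "continuous_on {t - \<delta>..t} x"
        using sol \<delta> t by (auto simp: solution_def intro: continuous_on_subset)
      then show "continuous_on {t - \<delta>..t} f"
        unfolding f_def[abs_def] by (intro continuous_intros)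
    qed (use \<delta> in simp)
    moreover have "x (t - \<delta>) $ 1 \<ge> 0"
      using sol \<delta> t flowsD(1) by (auto simp: solution_def)
    ultimately show False
      using small(2) by (simp add: f_def algebra_simps)
  qed
  then show ?thesis
    using \<eta> \<delta> h_pos by (intro exI[of _ "min (\<eta> / 2) (h * \<delta> / 2)"]) auto
qed

text \<open>A strongly negative cost of any path would attract users of \<open>P\<^sub>1\<close>, which carries a definite
  mass, and so violate the decay of the disequilibrium.\<close>

lemma cost_bounded_below:
  assumes t: "t > 0"
  shows "\<exists>B. \<forall>e>0. \<forall>x. solution e x \<longrightarrow> cost e (x t) k \<ge> - B"
proof -
  obtain \<mu> where \<mu>: "\<mu> > 0" "\<And>e x. e > 0 \<Longrightarrow> solution e x \<Longrightarrow> x t $ 1 \<ge> \<mu>"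
    using first_path_bounded_below[OF t] by blast
  have "cost e (x t) k \<ge> - sqrt (12 / t\<^sup>2 / \<mu>)" if e: "e > 0" and sol: "solution e x" for e x
  proof -
    have xt: "x t \<in> flows"
      using sol t by (simp add: solution_def)
    let ?r = "max 0 (cost e (x t) 1 - cost e (x t) k)"
    have "\<mu> * ?r\<^sup>2 \<le> x t $ 1 * ?r\<^sup>2"
      using \<mu>(2)[OF e sol] by (intro mult_right_mono) auto
    also have "\<dots> \<le> 12 / t\<^sup>2"
      by (rule order_trans[OF mult_excess_square_le_disequilibrium V_le[OF sol e t]])
        (rule flowsD(1)[OF xt])
    finally have "?r\<^sup>2 \<le> 12 / t\<^sup>2 / \<mu>"
      using \<mu>(1) by (subst le_divide_eq) (simp add: mult.commute)
    then have "?r \<le> sqrt (12 / t\<^sup>2 / \<mu>)"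
      by (rule real_le_rsqrt)
    then show ?thesis
      using cost1_nonneg[OF xt, of e] by linarith
  qed
  then show ?thesis by blast
qed

text \<open>Since \<open>x t $ 1\<close> is bounded below, a tiny denominator would make the cost of
  its path strongly negative. The bound is uniform in \<open>e\<close>, so it survives the limit and
  makes the limiting flow nondegenerate.\<close>

lemma singular_paths_bounded_below:
  assumes t: "t > 0"
  shows "\<exists>m>0. \<forall>e>0. \<forall>x. solution e x \<longrightarrow>
     (\<alpha> = 0 \<or> x t $ 2 + e \<ge> m) \<and> (\<beta> = 0 \<or> x t $ 3 + e \<ge> m)"
proof -
  obtain \<mu> where \<mu>: "\<mu> > 0" "\<And>e x. e > 0 \<Longrightarrow> solution e x \<Longrightarrow> x t $ 1 \<ge> \<mu>"
    using first_path_bounded_below[OF t] by blast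
  obtain B2 where B2: "\<And>e x. e > 0 \<Longrightarrow> solution e x \<Longrightarrow> cost e (x t) 2 \<ge> - B2"
    using cost_bounded_below[OF t] by blast
  obtain B3 where B3: "\<And>e x. e > 0 \<Longrightarrow> solution e x \<Longrightarrow> cost e (x t) 3 \<ge> - B3"
    using cost_bounded_below[OF t] by blast
  \<comment> \<open>The summand \<open>2 * h\<close> absorbs the nonsingular part of the costs and
    makes \<open>B\<close> positive.\<close>
  define B where "B = max 0 (max B2 B3) + 2 * h"
  have B: "B > 0"
    using h_pos by (simp add: B_def add_nonneg_pos)
  have bound: "h * c * \<mu>\<^sup>2 / B \<le> y"
    if "x1 \<ge> \<mu>" "c \<ge> 0" "y > 0" "h * (c * x1\<^sup>2 / y) \<le> B" for c x1 y
  proof -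
    have "h * c * \<mu>\<^sup>2 \<le> h * c * x1\<^sup>2"
      using that h_pos \<mu>(1) by (intro mult_left_mono power_mono) auto
    also have "\<dots> \<le> B * y"
      using that by (simp add: field_simps)
    finally show ?thesis
      using B by (simp add: field_simps)
  qed
  define m where "m = min (if \<alpha> = 0 then 1 else h * \<alpha> * \<mu>\<^sup>2 / B) (if \<beta> = 0 then 1 else h * (2 * \<beta>) * \<mu>\<^sup>2 / B)"
  have "m > 0"
    using h_pos \<alpha>\<beta>(1,4) \<mu>(1) B by (simp add: m_def)
  moreover have "(\<alpha> = 0 \<or> x t $ 2 + e \<ge> m) \<and> (\<beta> = 0 \<or> x t $ 3 + e \<ge> m)"
    if e: "e > 0" and sol: "solution e x" for e x
  proof -
    have xt: "x t \<in> flows"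
      using sol t by (simp add: solution_def)
    have "h * (1 + x t $ 3) \<le> h * 2" "h * (2 - x t $ 2) \<le> h * 2"
      using h_pos flowsD(1,2)[OF xt] by (auto intro!: mult_left_mono)
    then have "h * (\<alpha> * (x t $ 1)\<^sup>2 / (x t $ 2 + e)) \<le> B" "h * (2 * \<beta> * (x t $ 1)\<^sup>2 / (x t $ 3 + e)) \<le> B"
      using B2[OF e sol] B3[OF e sol] unfolding cost_simps right_diff_distrib[of h "_ - _"] right_diff_distrib[of h "_ + _"] B_def by linarith+
    then have "h * \<alpha> * \<mu>\<^sup>2 / B \<le> x t $ 2 + e" "h * (2 * \<beta>) * \<mu>\<^sup>2 / B \<le> x t $ 3 + e"
      using \<mu>(2)[OF e sol] \<alpha>\<beta> e flowsD(1)[OF xt] by (intro bound; simp add: add_nonneg_pos)+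
    then show ?thesis
      by (auto simp: m_def)
  qed
  ultimately show ?thesis by blast
qed

lemma solution_exists:
  assumes x0: "x0 \<in> flows"
  shows "\<exists>x. x 0 = x0 \<and> solution 0 x"
proof -
  define E where "E n = inverse (real (Suc n))" for n
  have E: "E n > 0" for n
    by (simp add: E_def)
  have "\<forall>n. \<exists>x. x 0 = x0 \<and> solution (E n) x"
    using regularised_solution_exists[OF E x0] by blast
  then obtain X where X: "\<And>n. X n 0 = x0" "\<And>n. solution (E n) (X n)"
    by metis
  have X_flow: "X n t \<in> flows" if "t \<ge> 0" for n t
    using X(2) that by (simp add: solution_def)
  have X_dist: "dist (X n s) (X n t) \<le> 6 * sqrt (10 * h * \<bar>s - t\<bar>)" if "s \<ge> 0" "t \<ge> 0" for n s t
  proof -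
    have comp: "\<bar>(X n s - X n t) $ k\<bar> \<le> 2 * sqrt (10 * h * \<bar>s - t\<bar>)" for k
      using solution_equicontinuous[OF X(2) E, where k = k and s = s and t = t]
        solution_equicontinuous[OF X(2) E, where k = k and s = t and t = s] that
      by (cases "s \<le> t") (auto simp: abs_minus_commute)
    show ?thesis
      using norm_le_l1_cart[of "X n s - X n t"] comp[of 1] comp[of 2] comp[of 3]
      unfolding dist_norm sum_3 by linarith
  qed
  obtain \<kappa> x where \<kappa>: "strict_mono (\<kappa> :: nat \<Rightarrow> nat)"
    and lim: "\<And>t. t \<ge> 0 \<Longrightarrow> (\<lambda>n. X (\<kappa> n) t) \<longlonglongrightarrow> x t" and cont: "continuous_on {0..} x"
  proof (rule equicontinuous_convergent_subsequence[of X 1])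
    show "norm (X n t) \<le> 1" if "t \<ge> 0" for n t
      using norm_le_l1_cart[of "X n t"] flowsD(1,3)[OF X_flow[OF that, of n]] by simp
    show "\<exists>d>0. \<forall>n s t. s \<ge> 0 \<and> t \<ge> 0 \<and> \<bar>s - t\<bar> < d \<longrightarrow> dist (X n s) (X n t) < e" if "e > 0" for e
    proof (intro exI[of _ "(e / 6)\<^sup>2 / (10 * h)"] conjI allI impI)
      fix n and s t :: real
      assume *: "s \<ge> 0 \<and> t \<ge> 0 \<and> \<bar>s - t\<bar> < (e / 6)\<^sup>2 / (10 * h)"
      then have "10 * h * \<bar>s - t\<bar> < (e / 6)\<^sup>2"
        using h_pos by (simp add: less_divide_eq mult.commute)
      then have "sqrt (10 * h * \<bar>s - t\<bar>) < e / 6"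
        using that by (intro real_less_lsqrt) auto
      then show "dist (X n s) (X n t) < e"
        using X_dist[of s t n] * by simp
    qed (use that h_pos in simp)
  qed (rule that)
  have E_lim: "(\<lambda>n. E (\<kappa> n)) \<longlonglongrightarrow> 0"
    using LIMSEQ_subseq_LIMSEQ[OF LIMSEQ_inverse_real_of_nat \<kappa>] by (simp add: E_def o_def)
  have nth_lim: "(\<lambda>n. X (\<kappa> n) t $ k) \<longlonglongrightarrow> x t $ k" if "t \<ge> 0" for t k
    using lim[OF that] by (rule tendsto_vec_nth)
  have flow: "x t \<in> flows" if "t \<ge> 0" for t
  proof (rule flowsI)
    show "x t $ k \<ge> 0" for k
      by (rule LIMSEQ_le_const[OF nth_lim[OF that]]) (use flowsD(1)[OF X_flow[OF that]] in blast)
    have "(\<lambda>n. X (\<kappa> n) t $ 1 + X (\<kappa> n) t $ 2 + X (\<kappa> n) t $ 3) \<longlonglongrightarrow> x t $ 1 + x t $ 2 + x t $ 3"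
      by (intro tendsto_add nth_lim that)
    then show "x t $ 1 + x t $ 2 + x t $ 3 = 1"
      using flowsD(4)[OF X_flow[OF that]] by (simp add: LIMSEQ_const_iff)
  qed
  have nondeg: "nondegenerate 0 (x t)" if t: "t > 0" for t
  proof -
    obtain m where m: "m > 0" "\<And>e x. e > 0 \<Longrightarrow> solution e x \<Longrightarrow>
        (\<alpha> = 0 \<or> x t $ 2 + e \<ge> m) \<and> (\<beta> = 0 \<or> x t $ 3 + e \<ge> m)"
      using singular_paths_bounded_below[OF t] by blast
    have lim': "(\<lambda>n. X (\<kappa> n) t $ k + E (\<kappa> n)) \<longlonglongrightarrow> x t $ k + 0" for k
      using t by (intro tendsto_add nth_lim E_lim) auto
    have "x t $ 2 + 0 \<ge> m" if "\<alpha> \<noteq> 0"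
      using m(2)[OF E X(2)] that by (intro LIMSEQ_le_const[OF lim']) auto
    moreover have "x t $ 3 + 0 \<ge> m" if "\<beta> \<noteq> 0"
      using m(2)[OF E X(2)] that by (intro LIMSEQ_le_const[OF lim']) auto
    ultimately show ?thesis
      using m(1) unfolding nondegenerate_def by (meson less_le_trans)
  qed
  have "((\<lambda>s. x s $ k) has_real_derivative smith_field (cost 0 (x t)) (x t) k) (at t)"
    if t: "t > 0" for t k
  proof -
    \<comment> \<open>The rates are bounded uniformly in \<open>e\<close> only away from time 0. So
      the integrated equation is taken from a positive time \<open>a\<close>, where
      \<open>V_le\<close> bounds the disequilibrium by \<open>12 / a\<^sup>2\<close> and dominated
      convergence applies.\<close>
    define a where "a = t / 2"
    have a: "a > 0" "a < t"
      using t by (auto simp: a_def)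
    define f where "f u = smith_field (cost 0 (x u)) (x u) k" for u
    define F where "F n u = smith_field (cost (E (\<kappa> n)) (X (\<kappa> n) u)) (X (\<kappa> n) u) k" for n u
    have F_int: "(F n has_integral X (\<kappa> n) b $ k - X (\<kappa> n) a $ k) {a..b}" if "a \<le> b" for n b
      using X(2)[of "\<kappa> n"] a that
      by (intro fundamental_theorem_of_calculus)
        (auto simp: solution_def F_def has_real_derivative_iff_has_vector_derivative
          intro: has_vector_derivative_at_within)
    have integral: "integral {a..b} f = x b $ k - x a $ k" if b: "a \<le> b" for b
    proof (rule LIMSEQ_unique)
      show "(\<lambda>n. integral {a..b} (F n)) \<longlonglongrightarrow> integral {a..b} f"
      proof (rule dominated_convergence(2))
        show "F n integrable_on {a..b}" for n
          using F_int[OF b] by blast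
        show "(\<lambda>u. 3 * (1 + 12 / a\<^sup>2)) integrable_on {a..b}"
          by (intro integrable_continuous_real continuous_intros)
        show "norm (F n u) \<le> 3 * (1 + 12 / a\<^sup>2)" if "u \<in> {a..b}" for n u
        proof -
          have u: "u > 0" "a \<le> u"
            using that a by auto
          have "12 / u\<^sup>2 \<le> 12 / a\<^sup>2"
            using u a by (intro divide_left_mono power_mono) auto
          then have "V (E (\<kappa> n)) (X (\<kappa> n) u) \<le> 12 / a\<^sup>2"
            using V_le[OF X(2) E u(1), of "\<kappa> n"] by linarith
          then show ?thesis
            using abs_smith_field_le[of "X (\<kappa> n) u" "cost (E (\<kappa> n)) (X (\<kappa> n) u)" k]
              flowsD(1,2)[OF X_flow[of u]] u by (simp add: F_def)
        qed
        show "(\<lambda>n. F n u) \<longlonglongrightarrow> f u" if "u \<in> {a..b}" for u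
          unfolding F_def f_def using that a
          by (intro smith_field_tendsto cost_tendsto lim E_lim nondeg) auto
      qed
      show "(\<lambda>n. integral {a..b} (F n)) \<longlonglongrightarrow> x b $ k - x a $ k"
        using nth_lim a b by (simp add: integral_unique[OF F_int[OF b]] tendsto_diff)
    qed
    have "continuous_on {a..} x"
      using cont a by (auto intro: continuous_on_subset)
    then have "continuous_on {a..} f"
      using nondeg a unfolding continuous_on_def f_def
      by (auto intro!: smith_field_tendsto cost_tendsto)
    then have "((\<lambda>u. integral {a..u} f) has_vector_derivative f t) (at t within {a..})"
      using a by (intro integral_has_vector_derivative_atLeast) auto
    moreover have "at t within {a..} = at t"
      using a by (intro at_within_interior) simp
    ultimately have "((\<lambda>u. integral {a..u} f) has_vector_derivative f t) (at t)"
      by simp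
    then have "((\<lambda>u. x u $ k - x a $ k) has_vector_derivative f t) (at t)"
      by (rule has_vector_derivative_transform_within_open[where S = "{a<..}"]) (use a integral in auto)
    then have "((\<lambda>u. x u $ k - x a $ k) has_real_derivative f t) (at t)"
      by (simp add: has_real_derivative_iff_has_vector_derivative)
    from DERIV_add[OF this DERIV_const[of "x a $ k"]] show ?thesis
      by (simp add: f_def)
  qed
  moreover have "x 0 = x0"
    using lim[of 0] X(1) by (simp add: LIMSEQ_const_iff)
  ultimately show ?thesis
    using cont flow nondeg by (intro exI[of _ x]) (simp add: solution_def)
qed

section \<open>Convergence, equilibrium and stability\<close>

lemma solution_converges:
  assumes sol: "solution 0 x"
  shows "(x \<longlongrightarrow> z) at_top"
proof -
  \<comment> \<open>The decay is measured from time 1, because the initial flow may be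
    singular.\<close>
  have "((\<lambda>t::real. 12 / (t - 1)\<^sup>2) \<longlongrightarrow> 0) at_top"
    by real_asymp
  then have "((\<lambda>t. V 0 (x t)) \<longlongrightarrow> 0) at_top"
  proof (rule tendsto_sandwich[rotated 3])
    show "\<forall>\<^sub>F t in at_top. V 0 (x t) \<ge> 0"
      using eventually_ge_at_top[of 0]
      by (rule eventually_mono) (use sol in \<open>auto simp: solution_def intro: V_nonneg\<close>)
    show "\<forall>\<^sub>F t in at_top. V 0 (x t) \<le> 12 / (t - 1)\<^sup>2"
      using eventually_gt_at_top[of 1]
      by (rule eventually_mono) (use sol in \<open>auto simp: solution_def intro!: V_decay\<close>)
  qed simp
  then have "((\<lambda>t. sqrt (216 / h * sqrt (3 * V 0 (x t)))) \<longlongrightarrow> sqrt (216 / h * sqrt (3 * 0))) at_top"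
    by (intro tendsto_intros)
  then have "((\<lambda>t. sqrt (216 / h * sqrt (3 * V 0 (x t)))) \<longlongrightarrow> 0) at_top"
    by simp
  then have "((\<lambda>t. dist (x t) z) \<longlongrightarrow> 0) at_top"
  proof (rule tendsto_sandwich[where f = "\<lambda>_. 0", rotated 3])
    show "\<forall>\<^sub>F t in at_top. dist (x t) z \<le> sqrt (216 / h * sqrt (3 * V 0 (x t)))"
      using eventually_gt_at_top[of 0]
      by (rule eventually_mono, intro dist_le_V) (use sol in \<open>auto simp: solution_def\<close>)
  qed simp_all
  then show ?thesis
    by (rule tendsto_dist_iff[THEN iffD2])
qed

lemma payoff_eq:
  assumes "x \<in> flows" "regular x"
  shows "payoff N (side_payments N z) x k =
    ereal (valuation N * total_content N x - real_perceived_cost x k)"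
proof -
  have diff_diff: "A - ereal c - g = A - (ereal c + g)" for A c and g :: ereal
    by (cases A; cases g) auto
  show ?thesis
    unfolding payoff_def diff_diff perceived_cost_def[symmetric] perceived_cost_eq[OF assms] by simp
qed

text \<open>Wardrop's conditions at the target: the ratios \<open>\<alpha>\<close> and
  \<open>\<beta>\<close> turn the costs of used paths into
  \<open>h * (\<alpha> + 2 * \<beta>) * z $ 1\<close>.\<close>

lemma cost_z:
  shows "cost 0 z k \<ge> cost 0 z 1" "z $ k > 0 \<Longrightarrow> cost 0 z k = cost 0 z 1"
proof -
  \<comment> \<open>Expanding the constant 1 in this way makes the costs at \<open>z\<close>
    homogeneous in \<open>z $ 1\<close>.\<close>
  have one: "1 = z $ 1 * (1 + \<alpha> + \<beta>)"
    using z_normalised by simp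
  have two: "cost 0 z 2 = cost 0 z 1" if "\<alpha> > 0"
  proof -
    have "cost 0 z 2 = h * (1 + \<beta> * z $ 1 - z $ 1)"
      using that z1_pos by (simp add: cost_simps z_eq power2_eq_square)
    also have "1 + \<beta> * z $ 1 - z $ 1 = (\<alpha> + 2 * \<beta>) * z $ 1"
      by (subst one) (simp add: algebra_simps)
    finally show ?thesis
      by (simp add: cost_simps)
  qed
  have three: "cost 0 z 3 = cost 0 z 1" if "\<beta> > 0"
  proof -
    have "cost 0 z 3 = h * (2 * 1 - \<alpha> * z $ 1 - 2 * z $ 1)"
      using that z1_pos by (simp add: cost_simps z_eq power2_eq_square)
    also have "2 * 1 - \<alpha> * z $ 1 - 2 * z $ 1 = (\<alpha> + 2 * \<beta>) * z $ 1"
      by (subst one) (simp add: algebra_simps)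
    finally show ?thesis
      by (simp add: cost_simps)
  qed
  have "cost 0 z 2 \<ge> cost 0 z 1" if "\<not> \<alpha> > 0"
    using that \<alpha>\<beta> h_pos z1_pos by (auto simp: cost_simps z_eq)
  moreover have "cost 0 z 3 \<ge> cost 0 z 1" if "\<not> \<beta> > 0"
  proof -
    have "\<alpha> * z $ 1 \<le> 1 * 1"
      using \<alpha>\<beta> flowsD(1,2)[OF z_flow, of 1] by (intro mult_mono) auto
    then have "h * (\<alpha> * z $ 1) \<le> h * (2 - \<alpha> * z $ 1)"
      using h_pos by (intro mult_left_mono) auto
    then show ?thesis
      using that \<alpha>\<beta>(1) by (simp add: cost_simps z_eq mult.assoc)
  qed
  ultimately show "cost 0 z k \<ge> cost 0 z 1"
    using two three exhaust_3[of k] by (metis order_refl)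
  show "cost 0 z k = cost 0 z 1" if "z $ k > 0"
    using that two three exhaust_3[of k] z1_pos by (auto simp: z_eq zero_less_mult_iff)
qed

lemma V_z: "V 0 z = 0"
proof -
  have "z $ k * (max 0 (cost 0 z k - cost 0 z l))\<^sup>2 = 0" for k l
  proof (cases "z $ k > 0")
    case True
    then show ?thesis
      using cost_z(1)[of l] cost_z(2)[of k] by simp
  next
    case False
    then show ?thesis
      using flowsD(1)[OF z_flow, of k] by simp
  qed
  then show ?thesis
    unfolding disequilibrium_def by (simp only: sum.neutral_const)
qed

lemma equilibrium_z: "equilibrium N (side_payments N z) z"
proof -
  have "real_perceived_cost z k \<le> real_perceived_cost z l" if "z $ k > 0" for k l
  proof -
    have "real_perceived_cost z k = cost 0 z 1"
      using that cost_z(2)[OF that] by (auto simp: real_perceived_cost_def)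
    \<comment> \<open>The value \<open>2 * h\<close> on an empty third path only makes deviating to
      it less attractive.\<close>
    moreover have "real_perceived_cost z l \<ge> cost 0 z l"
      using h_pos \<alpha>\<beta> z1_pos flowsD(1)[OF z_flow, of 2] by (auto simp: real_perceived_cost_def cost_simps)
    ultimately show ?thesis
      using cost_z(1)[of l] by linarith
  qed
  then show ?thesis
    using z_flow by (simp add: equilibrium_def payoff_eq nondegenerate_imp_regular nondegenerate_z)
qed

text \<open>Lyapunov's argument: \<open>?G (V 0 y)\<close> bounds the distance to \<open>z\<close>,
  is continuous and 0 at \<open>z\<close>, and does not increase along solutions. Near
  \<open>z\<close> flows are nondegenerate, so this applies from time 0 on.\<close>

lemma stable:
  assumes "\<epsilon> > 0"
  shows "\<exists>\<delta>>0. \<forall>x. solution 0 x \<and> dist (x 0) z < \<delta> \<longrightarrow> (\<forall>t\<ge>0. dist (x t) z < \<epsilon>)"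
proof -
  let ?G = "\<lambda>v. sqrt (216 / h * sqrt (3 * v))"
  have "((\<lambda>y. ?G (V 0 y)) \<longlongrightarrow> ?G (V 0 z)) (nhds z)"
    by (intro tendsto_intros V_tendsto nondegenerate_z) (simp add: filterlim_def)
  then have "\<forall>\<^sub>F y in nhds z. ?G (V 0 y) < \<epsilon>"
    using assms by (intro order_tendstoD(2)) (auto simp: V_z)
  moreover have "\<forall>\<^sub>F y in nhds z. nondegenerate 0 y"
  proof -
    have pos: "\<forall>\<^sub>F y in nhds z. y $ k > 0" if "z $ k > 0" for k
      using that by (intro order_tendstoD(1)[of "\<lambda>y. y $ k" "z $ k"] tendsto_vec_nth) (auto simp: filterlim_def)
    have "\<forall>\<^sub>F y in nhds z. \<alpha> = 0 \<or> y $ 2 > 0" "\<forall>\<^sub>F y in nhds z. \<beta> = 0 \<or> y $ 3 > 0"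
      using nondegenerate_z pos[of 2] pos[of 3] by (auto simp: nondegenerate_def elim: eventually_mono)
    then show ?thesis
      by eventually_elim (auto simp: nondegenerate_def)
  qed
  ultimately have "\<forall>\<^sub>F y in nhds z. ?G (V 0 y) < \<epsilon> \<and> nondegenerate 0 y"
    by (rule eventually_conj)
  then obtain \<delta> where \<delta>: "\<delta> > 0" "\<And>y. dist y z < \<delta> \<Longrightarrow> ?G (V 0 y) < \<epsilon> \<and> nondegenerate 0 y"
    unfolding eventually_nhds_metric by blast
  have "dist (x t) z < \<epsilon>" if sol: "solution 0 x" and x0: "dist (x 0) z < \<delta>" and t: "t \<ge> 0" for x t
  proof -
    have "nondegenerate 0 (x t)"
      using sol t \<delta>(2)[OF x0] by (cases "t = 0") (auto simp: solution_def)
    then have "dist (x t) z \<le> ?G (V 0 (x t))"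
      using sol t by (intro dist_le_V) (auto simp: solution_def)
    also have "\<dots> \<le> ?G (V 0 (x 0))"
      using V_nonincreasing[OF sol, of 0 t] t \<delta>(2)[OF x0] h_pos
      by (intro real_sqrt_le_mono mult_left_mono) auto
    also have "\<dots> < \<epsilon>"
      using \<delta>(2)[OF x0] by blast
    finally show ?thesis .
  qed
  then show ?thesis
    using \<delta>(1) by blast
qed

text \<open>An infinite subsidy on an empty path, or an empty first path, would attract users, so an
  equilibrium is nondegenerate. There all switching rates vanish, and \<open>dist_square_le\<close>
  gives distance 0.\<close>

lemma equilibrium_unique:
  assumes eq: "equilibrium N (side_payments N z) x"
  shows "x = z"
proof -
  have x: "x \<in> flows"
    and le: "\<And>k l. x $ k > 0 \<Longrightarrow> payoff N (side_payments N z) x l \<le> payoff N (side_payments N z) x k"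
    using eq by (auto simp: equilibrium_def)
  have cost_le: "real_perceived_cost x k \<le> real_perceived_cost x l" if "regular x" "x $ k > 0" for k l
    using le[OF that(2), of l] by (simp add: payoff_eq[OF x that(1)])
  have x1: "x $ 1 > 0"
  proof (rule ccontr)
    assume "\<not> ?thesis"
    then have x1: "x $ 1 = 0"
      using flowsD(1)[OF x, of 1] by simp
    then have reg: "regular x"
      by (simp add: regular_def)
    have "x $ 2 > 0 \<or> x $ 3 > 0"
      using x1 flowsD(4)[OF x] by linarith
    moreover have "real_perceived_cost x 1 = 0"
      using x1 by (simp add: real_perceived_cost_def cost_simps)
    moreover have "real_perceived_cost x 2 > 0" "real_perceived_cost x 3 > 0"
      using h_pos x1 flowsD(1)[OF x, of 3] flowsD(2)[OF x, of 2]
      by (auto simp: real_perceived_cost_def cost_simps intro!: mult_pos_pos)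
    ultimately show False
      using cost_le[OF reg, of 2 1] cost_le[OF reg, of 3 1] by linarith
  qed
  have finite1: "payoff N (side_payments N z) x 1 \<noteq> \<infinity>"
    by (simp add: payoff_def payments_simps side_payment1_eq[OF x])
  have no_infinite_subsidy: "payoff N (side_payments N z) x k \<noteq> \<infinity>" for k
    using le[OF x1, of k] finite1 by auto
  have x2: "x $ 2 > 0" if "\<alpha> \<noteq> 0"
  proof (rule ccontr)
    assume "\<not> ?thesis"
    then have "side_payments N z x 2 = - \<infinity>"
      using that \<alpha>\<beta> x1 flowsD(1)[OF x, of 2] by (simp add: payments_simps side_payment2_singular[OF x])
    then show False
      using no_infinite_subsidy[of 2] by (simp add: payoff_def)
  qed
  have x3: "x $ 3 > 0" if "\<beta> \<noteq> 0"
  proof (rule ccontr)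
    assume "\<not> ?thesis"
    then have x3: "x $ 3 = 0"
      using flowsD(1)[OF x, of 3] by simp
    have "\<alpha> \<noteq> 0" "\<beta> > 0"
      using that \<alpha>\<beta> by linarith+
    then have "side_payments N z x 3 = - \<infinity>"
      using x1 x3 x2 h_pos
      by (simp add: payments_simps collected_money[OF x] divide_ereal_def zero_less_mult_iff mult_less_0_iff)
    then show False
      using no_infinite_subsidy[of 3] by (simp add: payoff_def)
  qed
  have nd: "nondegenerate 0 x"
    using x2 x3 by (auto simp: nondegenerate_def)
  have no_switch: "x $ k * max 0 (cost 0 x k - cost 0 x l) = 0" for k l
  proof -
    have "switch_rate N (side_payments N z) x k l = 0"
    proof (cases "x $ k > 0")
      case True
      then show ?thesis
        using cost_le[OF nondegenerate_imp_regular[OF nd] True, of l]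
        by (simp add: switch_rate_def perceived_cost_eq[OF x nondegenerate_imp_regular[OF nd]])
    next
      case False
      then show ?thesis
        using flowsD(1)[OF x, of k] by (simp add: switch_rate_def zero_ereal_def[symmetric])
    qed
    then show ?thesis
      using switch_rate_eq[OF x nondegenerate_imp_regular[OF nd], of k l] by simp
  qed
  have "(dist x z)\<^sup>2 \<le> 0"
    using dist_square_le[OF x nd] by (simp only: no_switch sum.neutral_const mult_zero_right)
  then show ?thesis
    by simp
qed

text \<open>At the target the first payment is \<open>h * (\<alpha> + 2 * \<beta>) * z $ 1\<close>
  and the second is \<open>h * (\<beta> - 1) * z $ 1 \<le> 0\<close>. With \<open>z $ 2 = 0\<close>
  both payments would be 0 there, hence the hypothesis.\<close>

lemma side_payment_order:
  assumes "z $ 2 > 0"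
  shows "side_payments N z z 1 > side_payments N z z 2"
proof -
  have "\<alpha> > 0"
    using assms z1_pos by (simp add: \<alpha>_def)
  have "h * (z $ 3 - \<alpha> * (z $ 1)\<^sup>2 / z $ 2) = h * (\<beta> * z $ 1 - z $ 1)"
    using \<open>\<alpha> > 0\<close> z1_pos by (simp add: z_eq power2_eq_square)
  also have "\<dots> \<le> 0"
    using h_pos z1_pos \<alpha>\<beta> by (intro mult_nonneg_nonpos) (auto simp: mult_left_le_one_le)
  also have "\<dots> < h * (\<alpha> + 2 * \<beta>) * z $ 1"
    using h_pos z1_pos \<alpha>\<beta> \<open>\<alpha> > 0\<close> by (intro mult_pos_pos) auto
  finally show ?thesis
    using assms by (simp add: payments_simps side_payment1_eq[OF z_flow] side_payment2_eq[OF z_flow])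
qed

end

section \<open>Price of anarchy\<close>

lemma price_of_anarchy_side_payments: "price_of_anarchy side_payments = 1"
proof -
  define A where "A = {(N, z). valid_network N \<and> optimal_flow N z \<and> social_welfare N z > 0}"
  \<comment> \<open>Without link content the free path alone is optimal. This instance shows that
    the outer infimum ranges over a nonempty set; over the empty set it would be
    \<open>\<infinity>\<close>.\<close>
  define N\<^sub>0 where "N\<^sub>0 = \<lparr>valuation = 1, common_content = 1, link_content = (\<lambda>_. 0), high_cost = 1\<rparr>"
  define z\<^sub>0 where "z\<^sub>0 = (vector [1, 0, 0] :: real ^ 3)"
  have "valid_network N\<^sub>0"
    by (simp add: valid_network_def N\<^sub>0_def mono_on_def concave_on_def convex_on_const)
  moreover have "z\<^sub>0 \<in> flows"
    unfolding flows_def by (simp add: forall_3 sum_3 z\<^sub>0_def)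
  moreover have SW: "social_welfare N\<^sub>0 y = 1 - (y $ 2 / 2 + y $ 3)" for y
    by (simp add: social_welfare_def total_content_def travel_cost_def sum_3 N\<^sub>0_def)
  have "social_welfare N\<^sub>0 y \<le> social_welfare N\<^sub>0 z\<^sub>0" if "y \<in> flows" for y
    using flowsD(1)[OF that, of 2] flowsD(1)[OF that, of 3] by (simp add: SW z\<^sub>0_def)
  ultimately have "(N\<^sub>0, z\<^sub>0) \<in> A"
    by (simp add: A_def optimal_flow_def SW) (simp add: z\<^sub>0_def)
  then have "A \<noteq> {}"
    by blast
  have "(INF x \<in> {x. equilibrium N (side_payments N z) x}. ereal (social_welfare N x / social_welfare N z)) = 1"
    if "(N, z) \<in> A" for N z
  proof -
    have "optimal_network N z" "social_welfare N z > 0"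
      using that by (auto simp: A_def optimal_network_def)
    then have "{x. equilibrium N (side_payments N z) x} = {z}"
      using optimal_network.equilibrium_z optimal_network.equilibrium_unique by blast
    then show ?thesis
      using \<open>social_welfare N z > 0\<close> by (simp add: one_ereal_def)
  qed
  then have "(INF p \<in> A. (case p of (N, z) \<Rightarrow> INF x \<in> {x. equilibrium N (side_payments N z) x}.
      ereal (social_welfare N x / social_welfare N z))) = 1"
    using \<open>A \<noteq> {}\<close> by (intro INF_eq_const) auto
  then show ?thesis
    by (simp add: price_of_anarchy_def A_def)
qed

theorem proposition7:
  fixes N :: network and z :: "real ^ 3"
  assumes "valid_network N" and "optimal_flow N z"
  shows "incentivizes N (side_payments N z) z
    \<and> converges_from_any_flow N (side_payments N z) z
    \<and> (z $ 2 > 0 \<longrightarrow> side_payments N z z 1 > side_payments N z z 2)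
    \<and> (\<forall>x. equilibrium N (side_payments N z) x \<longrightarrow> social_welfare N x = social_welfare N z)
    \<and> price_of_anarchy side_payments = 1"
proof -
  interpret optimal_network N z
    using assms by unfold_locales
  have trajectory_iff: "trajectory N (side_payments N z) x \<longleftrightarrow> solution 0 x" for x
    using trajectory_imp_solution solution_imp_trajectory by blast
  \<comment> \<open>Attraction is global, so any radius serves in the second condition, here
    1.\<close>
  have "asymptotically_stable N (side_payments N z) z"
    unfolding asymptotically_stable_def trajectory_iff
    using stable solution_converges by (auto intro: exI[of _ 1])
  moreover have "converges_from_any_flow N (side_payments N z) z"
    unfolding converges_from_any_flow_def trajectory_iff
    using solution_exists solution_converges by blast
  ultimately show ?thesis
    using equilibrium_z equilibrium_unique side_payment_order price_of_anarchy_side_payments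
    by (auto simp: incentivizes_def)
qed

end
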